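(* Let $(H,\|\cdot\|)$ be a separable (real or complex) Hilbert space. If $X_1, \ldots, X_n$ are independent random variables of type $\mathscr{L}'$, then for all vectors $v_1, \ldots, v_n$ in $H$, the sum $X = \sum_{j=1}^n X_j v_j$ satisfies $$\|X\|_q \leq \frac{\|G\|_q}{\|G\|_p}\,\|X\|_p$$ for all positive even integers $p \leq q$, where $G$ is a standard (real) Gaussian random variable, $\|X\|_p = (\mathbb{E}\|X\|^p)^{1/p}$ and $\|G\|_p = (\mathbb{E}|G|^p)^{1/p}$.
   Context: A real-valued random variable $X$ is of type $\mathscr{L}'$ if (i) there are positive constants $C, C'$ such that $|\mathbb{E}\exp(zX)| \leq C\exp(C'|z|^2)$ for all $z \in \mathbb{C}$, and (ii') the function $z \mapsto \mathbb{E}\exp(zX)$ on $\mathbb{C}$ has only pure imaginary zeros (it may have no zeros at all). *)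

theory Defs
  imports "HOL-Probability.Probability"
begin

definition moment_fun :: "'w measure \<Rightarrow> ('w \<Rightarrow> real) \<Rightarrow> complex \<Rightarrow> complex" where
  "moment_fun M X z = (\<integral>\<omega>. exp (z * complex_of_real (X \<omega>)) \<partial>M)"

text \<open>
  Integrability is required explicitly, since the Bochner integral of a
  non-integrable function is 0 by convention.
\<close>

definition type_L' :: "'w measure \<Rightarrow> ('w \<Rightarrow> real) \<Rightarrow> bool" where
  "type_L' M X \<longleftrightarrow>
     X \<in> borel_measurable M \<and>
     (\<forall>z::complex. integrable M (\<lambda>\<omega>. exp (z * complex_of_real (X \<omega>)))) \<and>
     (\<exists>C>0. \<exists>C'>0. \<forall>z. norm (moment_fun M X z) \<le> C * exp (C' * (norm z)\<^sup>2)) \<and>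
     (\<forall>z. moment_fun M X z = 0 \<longrightarrow> Re z = 0)"

text \<open>
  The integral below is 0 if the \<open>p\<close>-th absolute moment is infinite. A finite linear
  combination of variables of type \<open>\<L>'\<close> has finite exponential moments,
  hence finite absolute moments of all orders, and so does a Gaussian variable.
\<close>

definition moment_norm :: "'w measure \<Rightarrow> nat \<Rightarrow> ('w \<Rightarrow> 'a::real_normed_vector) \<Rightarrow> real" where
  "moment_norm M p X = (\<integral>\<omega>. norm (X \<omega>) ^ p \<partial>M) powr (1 / real p)"

text \<open>
  Complex inner product spaces, with the inner product linear in its first argument.
  Positive definiteness of the inner product is contained in \<open>cinner_self\<close>.
\<close>

class complex_inner = real_normed_vector +
  fixes scaleC :: "complex \<Rightarrow> 'a \<Rightarrow> 'a"
    and cinner :: "'a \<Rightarrow> 'a \<Rightarrow> complex"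
  assumes scaleC_add_right: "scaleC a (x + y) = scaleC a x + scaleC a y"
    and scaleC_add_left: "scaleC (a + b) x = scaleC a x + scaleC b x"
    and scaleC_scaleC: "scaleC a (scaleC b x) = scaleC (a * b) x"
    and scaleC_one: "scaleC 1 x = x"
    and scaleR_scaleC: "scaleR r x = scaleC (complex_of_real r) x"
    and cinner_commute: "cinner x y = cnj (cinner y x)"
    and cinner_add_left: "cinner (x + y) z = cinner x z + cinner y z"
    and cinner_scaleC_left: "cinner (scaleC a x) y = a * cinner x y"
    and cinner_self: "cinner x x = complex_of_real ((norm x)\<^sup>2)"

instantiation complex :: complex_inner
begin

definition scaleC_complex :: "complex \<Rightarrow> complex \<Rightarrow> complex" where
  "scaleC_complex a x = a * x"

definition cinner_complex :: "complex \<Rightarrow> complex \<Rightarrow> complex" where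
  "cinner_complex x y = x * cnj y"

instance
proof
  fix x :: complex
  show "cinner x x = complex_of_real ((norm x)\<^sup>2)"
    unfolding cinner_complex_def by (rule complex_norm_square [symmetric])
qed (simp_all add: scaleC_complex_def cinner_complex_def distrib_left distrib_right
      scaleR_conv_of_real)

end

end

theory Submission
  imports Defs "HOL-Complex_Analysis.Complex_Analysis" "HOL-Real_Asymp.Real_Asymp"
begin

text \<open>
  The heart of the matter is the case of a single real variable \<open>S\<close> of type \<open>\<L>'\<close>, a class that is
  closed under linear combinations of independent variables. Its moment generating function \<open>f\<close> is
  entire of order at most two, and its zeros come in pairs \<open>\<plusminus>\<i> y\<close>. As in
  Hadamard's factorisation theorem, \<open>f\<close> is built from an exponential and the factors \<open>1 + z\<^sup>2 / y\<^sup>2\<close>: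
  after division by the factors of the zeros in a large disc, the logarithm of the cofactor
  is controlled by the Borel-Caratheodory inequality, so that the cofactor is nearly
  \<open>exp (a * z + \<beta> * z\<^sup>2)\<close> (\<open>lee_yang_log_expansion\<close>). Here \<open>\<beta> \<ge> 0\<close>, because otherwise \<open>f\<close> would decay too fast along the real axis to satisfy Jensen's inequality
  \<open>exp (a * x) \<le> f x\<close> (\<open>quad_coeff_cofactor_nonneg\<close>). Hence \<open>f\<close> is a limit of functions
  \<open>exp (a * z)\<close> times finite products of factors \<open>1 + b * z\<^sup>2\<close> with \<open>b \<ge> 0\<close> (\<open>lee_yang_approx\<close>).

  For such products let \<open>c k\<close> be the coefficient of \<open>z\<^sup>2\<^sup>k\<close>. The sequence \<open>k! * c k\<close> is log-concave:
  this is true of \<open>cosh (a * z)\<close> and is preserved by each factor, as in Newton's inequalities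
  (\<open>log_concave_seq_linear_factor\<close>). In the limit \<open>k! * E S\<^sup>2\<^sup>k / (2 k)!\<close> is log-concave, and this is, up to
  a factor \<open>2 ^ k\<close>, the quotient of the even moments of \<open>S\<close> and of a Gaussian variable.
  For a log-concave sequence \<open>u\<close> with \<open>u 0 = 1\<close> the \<open>k\<close>-th root of \<open>u k\<close> is nonincreasing, which is the moment
  comparison for \<open>S\<close> (\<open>type_L'_moment_comparison\<close>).

  For vectors, \<open>\<parallel>X\<parallel>\<^sup>2\<close> is a positive semidefinite quadratic form in the variables, hence a
  sum of squares of real linear forms. Averaging over a standard Gaussian vector \<open>g\<close>
  expresses \<open>\<parallel>X\<parallel>\<^sup>q\<close> through the moments of \<open>\<langle>X, g\<rangle>\<close>, to which the real case applies for every fixed \<open>g\<close>;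
  Minkowski's inequality for the exponent \<open>q / p \<ge> 1\<close> then exchanges the two averages
  (\<open>sum_of_squares_moment_comparison\<close>).
\<close>

section \<open>Entire functions with purely imaginary zeros\<close>

text \<open>
  A conjugate pair of zeros \<open>\<plusminus>\<i> y\<close> is recorded by the single number \<open>b = 1 / y\<^sup>2\<close>; a list is used so
  that multiple zeros are allowed and products can be treated by induction.
\<close>

definition quad_prod :: "real list \<Rightarrow> complex \<Rightarrow> complex" where
  "quad_prod bs z = (\<Prod>b\<leftarrow>bs. 1 + of_real b * z\<^sup>2)"

lemma quad_prod_Nil [simp]: "quad_prod [] z = 1"
  and quad_prod_Cons [simp]: "quad_prod (b # bs) z = (1 + of_real b * z\<^sup>2) * quad_prod bs z"
  by (simp_all add: quad_prod_def)

lemma quad_prod_append [simp]: "quad_prod (bs @ cs) z = quad_prod bs z * quad_prod cs z"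
  by (simp add: quad_prod_def)

lemma quad_prod_replicate [simp]: "quad_prod (replicate n b) z = (1 + of_real b * z\<^sup>2) ^ n"
  by (induction n) simp_all

lemma quad_prod_0 [simp]: "quad_prod bs 0 = 1"
  by (induction bs) simp_all

lemma holomorphic_quad_prod [holomorphic_intros]: "quad_prod bs holomorphic_on A"
proof (induction bs)
  case Nil
  have "quad_prod [] = (\<lambda>z. 1)" by (rule ext) simp
  then show ?case by simp
next
  case (Cons b bs)
  have "quad_prod (b # bs) = (\<lambda>z. (1 + of_real b * z\<^sup>2) * quad_prod bs z)" by (rule ext) simp
  then show ?case by (auto intro!: holomorphic_intros Cons)
qed

text \<open>
  The analytic properties of the moment generating function of a variable of type \<open>\<L>'\<close>.
  The symmetry under conjugation makes the purely imaginary zeros come in pairs.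
\<close>

definition lee_yang :: "(complex \<Rightarrow> complex) \<Rightarrow> bool" where
  "lee_yang f \<longleftrightarrow> f holomorphic_on UNIV \<and> f 0 = 1 \<and> (\<forall>z. f (cnj z) = cnj (f z)) \<and>
     (\<forall>z. f z = 0 \<longrightarrow> Re z = 0) \<and>
     (\<exists>C>0. \<exists>D>0. \<forall>z. norm (f z) \<le> C * exp (D * (norm z)\<^sup>2))"

lemma lee_yangD:
  assumes "lee_yang f"
  shows "f holomorphic_on A" "f 0 = 1" "f (cnj z) = cnj (f z)" "f z = 0 \<Longrightarrow> Re z = 0"
  using assms holomorphic_on_subset unfolding lee_yang_def by blast+

lemma entire_divide_root:
  assumes "f holomorphic_on UNIV" "f a = 0"
  obtains h where "h holomorphic_on UNIV" "\<And>z. f z = (z - a) * h z"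
proof
  let ?h = "\<lambda>z. if z = a then deriv f a else (f z - f a) / (z - a)"
  show "?h holomorphic_on UNIV"
    using pole_lemma_open[OF assms(1)] by simp
  show "f z = (z - a) * ?h z" for z
    using assms by auto
qed

text \<open>
  The class is closed under division by the factor of a pair of zeros. In the resulting cofactor
  the growth bound survives because the removed factor has modulus at least 1 outside a disc, and
  the conjugation symmetry extends from the complement of two points by continuity.
\<close>

lemma lee_yang_divide_root:
  assumes L: "lee_yang f" and fw: "f w = 0"
  obtains g b where "lee_yang g" "b > 0" "b * (norm w)\<^sup>2 = 1"
    "\<And>z. f z = (1 + of_real b * z\<^sup>2) * g z"
proof -
  have w0: "w \<noteq> 0" using lee_yangD(2)[OF L] fw by auto
  have Rw: "Re w = 0" using lee_yangD(4)[OF L] fw by blast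
  then have cw: "cnj w = - w" by (simp add: complex_eq_iff)
  obtain h where h: "h holomorphic_on UNIV" "\<And>z. f z = (z - w) * h z"
    using entire_divide_root lee_yangD(1)[OF L] fw by metis
  have "f (- w) = 0" using lee_yangD(3)[OF L, of w] cw fw by simp
  then have "h (- w) = 0" using h(2)[of "- w"] w0 by simp
  then obtain k where k: "k holomorphic_on UNIV" "\<And>z. h z = (z + w) * k z"
    using entire_divide_root[OF h(1), of "- w"] by auto
  define b where "b = 1 / (norm w)\<^sup>2"
  define g where "g = (\<lambda>z. k z / of_real b)"
  have b: "b > 0" "b * (norm w)\<^sup>2 = 1" using w0 by (auto simp: b_def)
  have w2: "w\<^sup>2 = - of_real ((norm w)\<^sup>2)"
    using complex_norm_square[of w] cw by (simp add: power2_eq_square)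
  have fg: "f z = (1 + of_real b * z\<^sup>2) * g z" for z
  proof -
    have "f z = (z\<^sup>2 - w\<^sup>2) * k z"
      by (simp add: h(2) k(2) algebra_simps power2_eq_square)
    also have "z\<^sup>2 - w\<^sup>2 = (1 + of_real b * z\<^sup>2) / of_real b"
      using w0 unfolding w2 b_def by (simp add: field_simps)
    finally show ?thesis by (simp add: g_def)
  qed
  have holg: "g holomorphic_on UNIV"
    unfolding g_def using b by (intro holomorphic_intros k) auto
  have contg: "continuous_on A g" for A
    using holg holomorphic_on_imp_continuous_on holomorphic_on_subset by blast
  have g0: "g 0 = 1" using fg[of 0] lee_yangD(2)[OF L] by simp
  have symm: "g (cnj z) = cnj (g z)" for z
  proof -
    let ?S = "{z. g (cnj z) = cnj (g z)}"
    have "closed ?S"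
      by (intro closed_Collect_eq continuous_intros continuous_on_compose2[OF contg[of UNIV]]) auto
    moreover have "UNIV - {w, - w} \<subseteq> ?S"
    proof
      fix z assume z: "z \<in> UNIV - {w, - w}"
      have "1 + of_real b * z\<^sup>2 \<noteq> 0"
      proof
        assume "1 + of_real b * z\<^sup>2 = 0"
        then have "of_real b * (z\<^sup>2 - w\<^sup>2) = 0"
          unfolding w2 b_def using w0 by (simp add: field_simps)
        then show False using z b by (simp add: power2_eq_iff)
      qed
      moreover have "(1 + of_real b * (cnj z)\<^sup>2) * g (cnj z) = cnj ((1 + of_real b * z\<^sup>2) * g z)"
        using lee_yangD(3)[OF L, of z] by (simp add: fg)
      then have "cnj (1 + of_real b * z\<^sup>2) * g (cnj z) = cnj (1 + of_real b * z\<^sup>2) * cnj (g z)"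
        by simp
      ultimately show "z \<in> ?S" by (simp only: mult_cancel_left complex_cnj_zero_iff) simp
    qed
    moreover have "closure (UNIV - {w, - w}) = UNIV"
      by (metis Compl_eq_Diff_UNIV Compl_empty_eq closure_complement empty_interior_finite finite.intros)
    ultimately have "UNIV \<subseteq> ?S" using closure_minimal by metis
    then show ?thesis by blast
  qed
  have imag: "Re z = 0" if "g z = 0" for z
    using fg[of z] that lee_yangD(4)[OF L] by simp
  obtain C D where CD: "C > 0" "D > 0" "\<And>z. norm (f z) \<le> C * exp (D * (norm z)\<^sup>2)"
    using L unfolding lee_yang_def by blast
  have "bounded (g ` cball 0 (2 * norm w))"
    by (rule compact_imp_bounded[OF compact_continuous_image[OF contg compact_cball]])
  then obtain K where K: "\<And>z. norm z \<le> 2 * norm w \<Longrightarrow> norm (g z) \<le> K"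
    unfolding bounded_iff by (force simp: mem_cball_0)
  have K0: "K \<ge> 0" using K[of 0] order_trans[OF norm_ge_zero[of "g 0"]] by simp
  have growth: "norm (g z) \<le> (C + K) * exp (D * (norm z)\<^sup>2)" for z
  proof (cases "norm z \<le> 2 * norm w")
    case True
    have "norm (g z) \<le> (C + K) * 1" using K[OF True] CD by simp
    also have "\<dots> \<le> (C + K) * exp (D * (norm z)\<^sup>2)"
      using CD K0 by (intro mult_left_mono) auto
    finally show ?thesis .
  next
    case False
    have "(2 * norm w)\<^sup>2 \<le> (norm z)\<^sup>2" using False by (intro power_mono) auto
    then have "b * (2 * norm w)\<^sup>2 \<le> b * (norm z)\<^sup>2" using b by (intro mult_left_mono) auto
    moreover have "b * (2 * norm w)\<^sup>2 = 4" using b by (simp add: power_mult_distrib)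
    ultimately have "4 \<le> b * (norm z)\<^sup>2" by linarith
    then have "4 \<le> norm (of_real b * z\<^sup>2)" using b by (simp add: norm_mult norm_power)
    then have "1 \<le> norm (1 + of_real b * z\<^sup>2)"
      using norm_triangle_ineq2[of "of_real b * z\<^sup>2" "-1"] by (simp add: add.commute)
    then have "norm (g z) * 1 \<le> norm (g z) * norm (1 + of_real b * z\<^sup>2)"
      by (intro mult_left_mono) auto
    also have "\<dots> = norm (f z)" by (simp add: fg norm_mult)
    also have "\<dots> \<le> (C + K) * exp (D * (norm z)\<^sup>2)"
      using CD(3)[of z] K0 by (smt (verit) exp_ge_zero mult_right_mono)
    finally show ?thesis by simp
  qed
  have "C + K > 0" using CD K0 by simp
  then have "lee_yang g"
    unfolding lee_yang_def using holg g0 symm imag growth CD by blast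
  then show ?thesis using that b fg by blast
qed

text \<open>
  The condition \<open>1 \<le> b * R\<^sup>2\<close> says that the zeros of the factor lie in the disc of radius \<open>R\<close>. On the
  circle of radius \<open>2 * R\<close> the term \<open>b * z\<^sup>2\<close> then has modulus at least 4.
\<close>

lemma norm_quad_prod_ge:
  assumes "\<forall>b\<in>set bs. 1 \<le> b * R\<^sup>2" "norm z = 2 * R"
  shows "norm (quad_prod bs z) \<ge> 3 ^ length bs"
  using assms(1)
proof (induction bs)
  case (Cons b bs)
  have "1 \<le> b * R\<^sup>2" using Cons by simp
  then have b: "b \<ge> 0" by (smt (verit) mult_neg_pos mult_nonpos_nonneg zero_le_power2)
  have "4 \<le> norm (of_real b * z\<^sup>2)"
    using Cons.prems b assms(2) by (simp add: norm_mult norm_power power_mult_distrib)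
  then have "3 \<le> norm (1 + of_real b * z\<^sup>2)"
    using norm_triangle_ineq2[of "of_real b * z\<^sup>2" "-1"] by (simp add: add.commute)
  moreover have "norm (quad_prod bs z) \<ge> 3 ^ length bs" using Cons by simp
  ultimately show ?case by (simp add: norm_mult mult_mono)
qed simp

text \<open>
  By the maximum principle on the disc of radius \<open>2 * R\<close>. The bound is used in two ways: at \<open>z = 0\<close> it
  limits how many pairs of zeros there can be, and elsewhere it bounds the cofactor
  independently of the number of zeros removed.
\<close>

lemma cofactor_bound:
  assumes "g holomorphic_on UNIV" "\<And>z. f z = quad_prod bs z * g z"
    and "\<And>z. norm (f z) \<le> C * exp (D * (norm z)\<^sup>2)"
    and "\<forall>b\<in>set bs. 1 \<le> b * R\<^sup>2" "norm z \<le> 2 * R" "R > 0"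
  shows "3 ^ length bs * norm (g z) \<le> C * exp (4 * D * R\<^sup>2)"
proof -
  have "norm (g z) \<le> C * exp (4 * D * R\<^sup>2) / 3 ^ length bs"
  proof (rule maximum_modulus_frontier[of g "cball 0 (2 * R)"])
    show "g holomorphic_on interior (cball 0 (2 * R))" "continuous_on (closure (cball 0 (2 * R))) g"
      using assms(1) holomorphic_on_imp_continuous_on holomorphic_on_subset by blast+
    fix z :: complex assume "z \<in> frontier (cball 0 (2 * R))"
    then have z: "norm z = 2 * R" using assms(6) by simp
    have "3 ^ length bs * norm (g z) \<le> norm (quad_prod bs z) * norm (g z)"
      using norm_quad_prod_ge[OF assms(4) z] by (intro mult_right_mono) auto
    also have "\<dots> \<le> C * exp (4 * D * R\<^sup>2)"
      using assms(3)[of z] z by (simp add: assms(2) norm_mult power_mult_distrib algebra_simps)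
    finally show "norm (g z) \<le> C * exp (4 * D * R\<^sup>2) / 3 ^ length bs"
      by (simp add: field_simps)
  qed (use assms in auto)
  then show ?thesis by (simp add: field_simps)
qed

text \<open>
  The number of factors that can be split off is bounded, so a factorisation with the
  largest number of factors exists; its cofactor cannot vanish in the disc, since otherwise one more
  factor could be split off.
\<close>

lemma lee_yang_factor:
  assumes L: "lee_yang f" and R: "R > 0"
  obtains bs g where "lee_yang g" "\<forall>b\<in>set bs. b > 0 \<and> 1 \<le> b * R\<^sup>2"
    "\<And>z. f z = quad_prod bs z * g z" "\<And>z. norm z \<le> R \<Longrightarrow> g z \<noteq> 0"
proof -
  obtain C D where CD: "C > 0" "D > 0" "\<And>z. norm (f z) \<le> C * exp (D * (norm z)\<^sup>2)"
    using L unfolding lee_yang_def by blast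
  define ok where "ok = (\<lambda>bs g. lee_yang g \<and> (\<forall>b\<in>set bs. b > 0 \<and> 1 \<le> b * R\<^sup>2) \<and>
    (\<forall>z. f z = quad_prod bs z * g z))"
  obtain m where m: "C * exp (4 * D * R\<^sup>2) < 3 ^ m"
    using real_arch_pow[of 3] by auto
  have bound: "length bs < m" if "ok bs g" for bs g
  proof -
    have "3 ^ length bs * norm (g 0) \<le> C * exp (4 * D * R\<^sup>2)"
      using that R CD(3) lee_yangD[of g] unfolding ok_def by (intro cofactor_bound) auto
    moreover have "g 0 = 1" using that lee_yangD unfolding ok_def by blast
    ultimately have "(3::real) ^ length bs \<le> C * exp (4 * D * R\<^sup>2)" by simp
    with m have "(3::real) ^ length bs < 3 ^ m" by (rule order.strict_trans1[rotated])
    then show ?thesis using power_less_imp_less_exp[of "3::real"] by auto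
  qed
  have "ok [] f" using L by (simp add: ok_def)
  then have ex: "\<exists>bs g. ok bs g \<and> length bs = 0" by force
  define n where "n = (GREATEST k. \<exists>bs g. ok bs g \<and> length bs = k)"
  have bd: "k \<le> m" if "\<exists>bs g. ok bs g \<and> length bs = k" for k
    using bound that by (auto simp: less_imp_le)
  have n: "\<exists>bs g. ok bs g \<and> length bs = n"
    unfolding n_def by (rule GreatestI_nat[of _ 0 m]) (use ex bd in blast)+
  have max: "k \<le> n" if "\<exists>bs g. ok bs g \<and> length bs = k" for k
    unfolding n_def by (rule Greatest_le_nat[of _ k m]) (use that bd in blast)+
  from n obtain bs g where bg: "ok bs g" "length bs = n" by blast
  have "g z \<noteq> 0" if z: "norm z \<le> R" for z
  proof
    assume "g z = 0"
    then obtain h b where h: "lee_yang h" "b > 0" "b * (norm z)\<^sup>2 = 1"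
      "\<And>z. g z = (1 + of_real b * z\<^sup>2) * h z"
      using lee_yang_divide_root bg unfolding ok_def by metis
    have "b * (norm z)\<^sup>2 \<le> b * R\<^sup>2" using z h by (intro mult_left_mono power_mono) auto
    then have "ok (b # bs) h" using bg h unfolding ok_def by (auto simp: algebra_simps)
    then show False using max[of "Suc n"] bg by fastforce
  qed
  then show ?thesis using that bg unfolding ok_def by blast
qed

section \<open>The logarithm of a zero-free cofactor\<close>

text \<open>
  The map \<open>w \<mapsto> w / (2 * M - w)\<close> sends the half plane \<open>Re w < M\<close> into the unit disc, so the Schwarz
  lemma applies to its composition with \<open>h\<close>.
\<close>

lemma Borel_Caratheodory_half:
  assumes h: "h holomorphic_on ball 0 R" "h 0 = 0" and R: "R > 0"
    and Re: "\<And>z. norm z < R \<Longrightarrow> Re (h z) < M" and z: "norm z \<le> R / 2"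
  shows "norm (h z) \<le> 2 * M"
proof -
  have M: "M > 0" using Re[of 0] h R by simp
  have less: "norm (h w) < norm (2 * of_real M - h w)" if "norm w < R" for w
  proof -
    have "0 < M * (M - Re (h w))" using Re[OF that] M by simp
    then have "(Re (h w))\<^sup>2 < (2 * M - Re (h w))\<^sup>2"
      by (simp add: power2_eq_square algebra_simps)
    then show ?thesis by (simp add: cmod_def)
  qed
  define \<phi> where "\<phi> = (\<lambda>w. h (of_real R * w) / (2 * of_real M - h (of_real R * w)))"
  have sub: "(\<lambda>w. of_real R * w) ` ball 0 1 \<subseteq> ball (0::complex) R" using R by (auto simp: norm_mult)
  have h': "(\<lambda>w. h (of_real R * w)) holomorphic_on ball 0 1"
    using holomorphic_on_compose_gen[OF _ h(1) sub] by (simp add: o_def holomorphic_intros)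
  have Rw: "norm (of_real R * w) < R" if "norm w < 1" for w :: complex
    using that R by (simp add: norm_mult)
  have nz: "2 * of_real M - h (of_real R * w) \<noteq> 0" if "norm w < 1" for w :: complex
    using less[OF Rw[OF that]] by auto
  define w where "w = z / of_real R"
  have w: "norm w \<le> 1 / 2" "z = of_real R * w"
    using z R by (auto simp: w_def norm_divide field_simps)
  have "norm (\<phi> w) \<le> norm w"
  proof (rule Schwarz_Lemma(1)[of \<phi>])
    show "\<phi> holomorphic_on ball 0 1"
      unfolding \<phi>_def using nz by (intro holomorphic_intros h') auto
    show "\<phi> 0 = 0" by (simp add: \<phi>_def h)
    show "norm (\<phi> u) < 1" if "norm u < 1" for u
      using less[OF Rw[OF that]] by (simp add: \<phi>_def norm_divide divide_less_eq)
  qed (use w in auto)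
  with w(1) have "norm (\<phi> w) \<le> 1 / 2" by linarith
  then have "norm (h z) / norm (2 * of_real M - h z) \<le> 1 / 2"
    unfolding \<phi>_def w(2) norm_divide .
  then have "2 * norm (h z) \<le> norm (2 * of_real M - h z)"
    using nz[of w] w by (simp add: field_simps)
  also have "\<dots> \<le> norm (2 * of_real M :: complex) + norm (h z)" by (rule norm_triangle_ineq4)
  also have "norm (2 * of_real M :: complex) = 2 * M" using M by (simp add: norm_mult)
  finally show ?thesis by simp
qed

text \<open>
  Cauchy's estimate on discs of radius \<open>R / 4\<close> bounds the third derivative.
\<close>

lemma cubic_Taylor_remainder:
  assumes h: "h holomorphic_on ball 0 R" and R: "R > 0"
    and B: "\<And>z. norm z \<le> R / 2 \<Longrightarrow> norm (h z) \<le> B" and z: "norm z \<le> R / 4"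
  shows "norm (h z - (h 0 + deriv h 0 * z + deriv (deriv h) 0 / 2 * z\<^sup>2)) \<le> 192 * B / R ^ 3 * norm z ^ 3"
proof -
  have "norm ((deriv ^^ 0) h z - (\<Sum>i\<le>2. (deriv ^^ i) h 0 * (z - 0) ^ i / fact i))
      \<le> (fact 3 * B / (R / 4) ^ 3) * norm (z - 0) ^ Suc 2 / fact 2"
  proof (rule complex_Taylor[where S = "cball 0 (R / 4)" and f = "\<lambda>i. (deriv ^^ i) h"])
    fix i and x :: complex assume x: "x \<in> cball 0 (R / 4)"
    have "(deriv ^^ i) h holomorphic_on ball 0 R"
      by (intro holomorphic_higher_deriv h) auto
    then show "((deriv ^^ i) h has_field_derivative (deriv ^^ Suc i) h x) (at x within cball 0 (R / 4))"
      using holomorphic_derivI[OF _ open_ball, of "(deriv ^^ i) h" 0 R x] x R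
      by (simp add: has_field_derivative_at_within)
  next
    fix x :: complex assume x: "x \<in> cball 0 (R / 4)"
    have sub: "cball x (R / 4) \<subseteq> cball 0 (R / 2)"
    proof
      fix y assume "y \<in> cball x (R / 4)"
      then show "y \<in> cball 0 (R / 2)" using x norm_triangle_ineq2[of y x]
        by (simp add: dist_norm norm_minus_commute)
    qed
    have sub': "cball 0 (R / 2) \<subseteq> ball (0::complex) R" using R by auto
    have "norm ((deriv ^^ 3) h x) \<le> fact 3 * B / (R / 4) ^ 3"
    proof (rule Cauchy_inequality)
      show "h holomorphic_on ball x (R / 4)"
        using h sub sub' ball_subset_cball holomorphic_on_subset by (meson order_trans)
      show "continuous_on (cball x (R / 4)) h"
        using h sub sub' holomorphic_on_imp_continuous_on holomorphic_on_subset by (meson order_trans)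
      show "norm (h y) \<le> B" if "norm (x - y) = R / 4" for y
        using sub that by (intro B) (auto simp: dist_norm subset_iff)
    qed (use R in auto)
    then show "norm ((deriv ^^ Suc 2) h x) \<le> fact 3 * B / (R / 4) ^ 3" by (simp add: numeral_3_eq_3)
  qed (use z R in auto)
  then show ?thesis
    by (simp add: numeral_2_eq_2 numeral_3_eq_3 power_divide algebra_simps)
qed

text \<open>
  The second Taylor coefficient at 0 of \<open>ln g\<close>, when \<open>g 0 = 1\<close>.
\<close>

definition quad_coeff :: "(complex \<Rightarrow> complex) \<Rightarrow> complex" where
  "quad_coeff g = (deriv (deriv g) 0 - (deriv g 0)\<^sup>2) / 2"

lemma deriv_exp_at_0:
  assumes h: "h holomorphic_on ball 0 R" "h 0 = 0" "R > 0"
    and g: "\<And>z. norm z < R \<Longrightarrow> g z = exp (h z)"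
  shows "deriv g 0 = deriv h 0" "deriv (deriv g) 0 = deriv (deriv h) 0 + (deriv h 0)\<^sup>2"
proof -
  have h': "deriv h holomorphic_on ball 0 R"
    using h by (intro holomorphic_deriv) auto
  have dg: "deriv g z = deriv h z * exp (h z)" if "z \<in> ball 0 R" for z
  proof -
    have "((\<lambda>z. exp (h z)) has_field_derivative deriv h z * exp (h z)) (at z)"
      using holomorphic_derivI[OF h(1) _ that] by (auto intro!: derivative_eq_intros)
    then have "(g has_field_derivative deriv h z * exp (h z)) (at z)"
      using has_field_derivative_transform_within_open[of "\<lambda>z. exp (h z)" _ z "ball 0 R" g] that g by auto
    then show ?thesis by (rule DERIV_imp_deriv)
  qed
  then show "deriv g 0 = deriv h 0" using h by simp
  have "((\<lambda>z. deriv h z * exp (h z)) has_field_derivative deriv (deriv h) 0 + (deriv h 0)\<^sup>2) (at 0)"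
    using holomorphic_derivI[OF h(1), of 0] holomorphic_derivI[OF h', of 0] h
    by (auto intro!: derivative_eq_intros simp: power2_eq_square)
  then have "(deriv g has_field_derivative deriv (deriv h) 0 + (deriv h 0)\<^sup>2) (at 0)"
    using has_field_derivative_transform_within_open[of _ _ 0 "ball 0 R" "deriv g"] h dg by auto
  then show "deriv (deriv g) 0 = deriv (deriv h) 0 + (deriv h 0)\<^sup>2" by (rule DERIV_imp_deriv)
qed

text \<open>
  Since \<open>M\<close> will be of order \<open>R\<^sup>2\<close>, the error is of order \<open>1 / R\<close> for fixed \<open>z\<close>: growth of order two
  leaves room for a quadratic polynomial in the exponent only.
\<close>

lemma zero_free_log_expansion:
  assumes g: "g holomorphic_on UNIV" "g 0 = 1" and R: "R > 0"
    and nz: "\<And>z. norm z \<le> R \<Longrightarrow> g z \<noteq> 0"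
    and bd: "\<And>z. norm z \<le> R \<Longrightarrow> norm (g z) < exp M" and z: "norm z \<le> R / 4"
  shows "\<exists>e. g z = exp (deriv g 0 * z + quad_coeff g * z\<^sup>2 + e) \<and> norm e \<le> 384 * M / R ^ 3 * norm z ^ 3"
proof -
  have "g holomorphic_on ball 0 R" using g holomorphic_on_subset by blast
  then obtain k where k: "k holomorphic_on ball 0 R" "\<And>z. z \<in> ball 0 R \<Longrightarrow> g z = exp (k z)"
    using contractible_imp_holomorphic_log[of g "ball 0 R"] nz
    by (metis convex_ball convex_imp_contractible less_imp_le mem_ball_0)
  define h where "h = (\<lambda>z. k z - k 0)"
  have "exp (k 0) = 1" using k(2)[of 0] g R by simp
  then have gh: "g z = exp (h z)" if "norm z < R" for z
    using k(2)[of z] that by (simp add: h_def exp_diff)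
  have h: "h holomorphic_on ball 0 R" "h 0 = 0"
    using k by (auto simp: h_def intro!: holomorphic_intros)
  have "Re (h z) < M" if "norm z < R" for z
    using bd[of z] gh[OF that] that by simp
  then have "norm (h z) \<le> 2 * M" if "norm z \<le> R / 2" for z
    using Borel_Caratheodory_half[OF h R _ that] by blast
  from cubic_Taylor_remainder[OF h(1) R this z]
  have "norm (h z - (deriv h 0 * z + deriv (deriv h) 0 / 2 * z\<^sup>2)) \<le> 384 * M / R ^ 3 * norm z ^ 3"
    using h by simp
  moreover have d: "deriv g 0 = deriv h 0" "quad_coeff g = deriv (deriv h) 0 / 2"
    using deriv_exp_at_0[OF h R gh] by (simp_all add: quad_coeff_def)
  ultimately have "norm (h z - (deriv g 0 * z + quad_coeff g * z\<^sup>2)) \<le> 384 * M / R ^ 3 * norm z ^ 3"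
    unfolding d by simp
  moreover have "g z = exp (deriv g 0 * z + quad_coeff g * z\<^sup>2 + (h z - (deriv g 0 * z + quad_coeff g * z\<^sup>2)))"
    using gh[of z] z R by (simp del: diff_diff_add)
  ultimately show ?thesis by blast
qed

lemma deriv_quad_factor:
  assumes g: "g holomorphic_on UNIV" "g 0 = 1" and f: "\<And>z. f z = (1 + of_real b * z\<^sup>2) * g z"
  shows "deriv f 0 = deriv g 0" "quad_coeff f = quad_coeff g + of_real b"
proof -
  have g': "deriv g holomorphic_on UNIV" using g by (intro holomorphic_deriv) auto
  have f_eq: "f = (\<lambda>z. (1 + of_real b * z\<^sup>2) * g z)" by (rule ext) (rule f)
  have "(f has_field_derivative 2 * of_real b * z * g z + (1 + of_real b * z\<^sup>2) * deriv g z) (at z)" for z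
    unfolding f_eq using holomorphic_derivI[OF g(1), of z]
    by (auto intro!: derivative_eq_intros simp: algebra_simps)
  then have df: "deriv f = (\<lambda>z. 2 * of_real b * z * g z + (1 + of_real b * z\<^sup>2) * deriv g z)"
    using DERIV_imp_deriv by blast
  then show d0: "deriv f 0 = deriv g 0" by simp
  have "(deriv f has_field_derivative 2 * of_real b + deriv (deriv g) 0) (at 0)"
    unfolding df using holomorphic_derivI[OF g(1), of 0] holomorphic_derivI[OF g', of 0] g
    by (auto intro!: derivative_eq_intros)
  then have "deriv (deriv f) 0 = 2 * of_real b + deriv (deriv g) 0" by (rule DERIV_imp_deriv)
  then show "quad_coeff f = quad_coeff g + of_real b"
    by (simp add: quad_coeff_def d0 field_simps)
qed

lemma deriv_quad_prod:
  assumes g: "g holomorphic_on UNIV" "g 0 = 1" and f: "\<And>z. f z = quad_prod bs z * g z"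
  shows "deriv f 0 = deriv g 0 \<and> quad_coeff f = quad_coeff g + of_real (sum_list bs)"
  using f
proof (induction bs arbitrary: f)
  case Nil
  then have "f = g" by auto
  then show ?case by simp
next
  case (Cons b bs)
  let ?k = "\<lambda>z. quad_prod bs z * g z"
  have k: "?k holomorphic_on UNIV" "?k 0 = 1" by (auto intro!: holomorphic_intros g)
  have "f z = (1 + of_real b * z\<^sup>2) * ?k z" for z using Cons.prems by (simp add: mult.assoc)
  from deriv_quad_factor[OF k this] Cons.IH[of ?k] show ?case by (simp add: add_ac)
qed

text \<open>
  A finite form of Hadamard's factorisation: removing the zeros in the disc of radius \<open>R\<close> leaves a
  function that is close to the exponential of a quadratic polynomial. The constant \<open>K\<close> is uniform
  in \<open>R\<close>, because the bound on the cofactor does not depend on the number of zeros removed.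
\<close>

lemma lee_yang_log_expansion:
  assumes L: "lee_yang f"
  obtains K where "K > 0" "\<And>R. R \<ge> 1 \<Longrightarrow> \<exists>bs g. lee_yang g \<and> (\<forall>b\<in>set bs. b > 0) \<and>
     (\<forall>z. f z = quad_prod bs z * g z) \<and>
     (\<forall>z. norm z \<le> R / 4 \<longrightarrow>
       (\<exists>e. g z = exp (deriv g 0 * z + quad_coeff g * z\<^sup>2 + e) \<and> norm e \<le> K / R * norm z ^ 3))"
proof -
  obtain C D where CD: "C > 0" "D > 0" "\<And>z. norm (f z) \<le> C * exp (D * (norm z)\<^sup>2)"
    using L unfolding lee_yang_def by blast
  define K where "K = \<bar>ln C\<bar> + 4 * D + 1"
  have K: "K > 0" using CD by (simp add: K_def)
  show ?thesis
  proof (rule that)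
    show "384 * K > 0" using K by simp
    fix R :: real assume R: "R \<ge> 1"
    then have R0: "R > 0" by simp
    obtain bs g where g: "lee_yang g" "\<forall>b\<in>set bs. b > 0 \<and> 1 \<le> b * R\<^sup>2"
      "\<And>z. f z = quad_prod bs z * g z" "\<And>z. norm z \<le> R \<Longrightarrow> g z \<noteq> 0"
      using lee_yang_factor[OF L R0] by metis
    have bd: "norm (g z) < exp (K * R\<^sup>2)" if "norm z \<le> R" for z
    proof -
      have "1 * norm (g z) \<le> 3 ^ length bs * norm (g z)" by (intro mult_right_mono) auto
      also have "\<dots> \<le> C * exp (4 * D * R\<^sup>2)"
        using g R that CD(3) lee_yangD[OF g(1)] by (intro cofactor_bound) auto
      also have "\<dots> = exp (ln C + 4 * D * R\<^sup>2)" using CD by (simp add: exp_add)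
      also have "\<dots> < exp (K * R\<^sup>2)"
      proof -
        have "\<bar>ln C\<bar> * 1 \<le> \<bar>ln C\<bar> * R\<^sup>2" using R by (intro mult_left_mono) auto
        moreover have "R\<^sup>2 \<ge> 1" using R by simp
        ultimately show ?thesis by (simp add: K_def algebra_simps)
      qed
      finally show ?thesis by simp
    qed
    have "\<exists>e. g z = exp (deriv g 0 * z + quad_coeff g * z\<^sup>2 + e) \<and> norm e \<le> 384 * K / R * norm z ^ 3"
      if "norm z \<le> R / 4" for z
      using zero_free_log_expansion[OF lee_yangD(1,2)[OF g(1)] _ g(4) bd that] R
      by (simp add: power2_eq_square power3_eq_cube field_simps)
    with g show "\<exists>bs g. lee_yang g \<and> (\<forall>b\<in>set bs. b > 0) \<and> (\<forall>z. f z = quad_prod bs z * g z) \<and>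
     (\<forall>z. norm z \<le> R / 4 \<longrightarrow>
       (\<exists>e. g z = exp (deriv g 0 * z + quad_coeff g * z\<^sup>2 + e) \<and> norm e \<le> 384 * K / R * norm z ^ 3))"
      by blast
  qed
qed

section \<open>Positivity of the quadratic coefficient\<close>

lemma norm_quad_prod_le_exp:
  assumes "\<forall>b\<in>set bs. b > 0"
  shows "norm (quad_prod bs (of_real x)) \<le> exp (sum_list bs * x\<^sup>2)"
  using assms
proof (induction bs)
  case (Cons b bs)
  have "norm (1 + of_real b * (of_real x)\<^sup>2 :: complex) = norm (of_real (1 + b * x\<^sup>2) :: complex)" by simp
  also have "\<dots> = 1 + b * x\<^sup>2" unfolding norm_of_real using Cons.prems by simp
  also have "\<dots> \<le> exp (b * x\<^sup>2)" by (rule exp_ge_add_one_self)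
  finally have "norm (1 + of_real b * (of_real x)\<^sup>2 :: complex) * norm (quad_prod bs (of_real x))
      \<le> exp (b * x\<^sup>2) * exp (sum_list bs * x\<^sup>2)"
    using Cons by (intro mult_mono) auto
  moreover have "exp (sum_list (b # bs) * x\<^sup>2) = exp (b * x\<^sup>2) * exp (sum_list bs * x\<^sup>2)"
    by (simp add: distrib_right exp_add)
  ultimately show ?case by (simp only: quad_prod_Cons norm_mult)
qed simp

text \<open>
  Each factor \<open>1 + b * x\<^sup>2\<close> is at most \<open>exp (b * x\<^sup>2)\<close>, and the numbers \<open>b\<close> that are moved into the
  exponent in this way exactly make up the difference between the quadratic coefficients of \<open>g\<close>
  and of the cofactor. The claim follows as the radius tends to infinity.
\<close>

lemma lee_yang_real_bound:
  assumes L: "lee_yang g"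
  shows "norm (g (of_real x)) \<le> exp (Re (deriv g 0) * x + Re (quad_coeff g) * x\<^sup>2)" (is "_ \<le> exp ?A")
proof -
  obtain K where K: "K > 0" "\<And>R. R \<ge> 1 \<Longrightarrow> \<exists>bs h. lee_yang h \<and> (\<forall>b\<in>set bs. b > 0) \<and>
     (\<forall>z. g z = quad_prod bs z * h z) \<and>
     (\<forall>z. norm z \<le> R / 4 \<longrightarrow>
       (\<exists>e. h z = exp (deriv h 0 * z + quad_coeff h * z\<^sup>2 + e) \<and> norm e \<le> K / R * norm z ^ 3))"
    using lee_yang_log_expansion[OF L] by blast
  have le: "norm (g (of_real x)) \<le> exp (?A + K * \<bar>x\<bar> ^ 3 / R)" if R: "R \<ge> 1" "R \<ge> 4 * \<bar>x\<bar>" for R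
  proof -
    obtain bs h where h: "lee_yang h" "\<forall>b\<in>set bs. b > 0" "\<And>z. g z = quad_prod bs z * h z"
      "\<And>z. norm z \<le> R / 4 \<Longrightarrow> 
       (\<exists>e. h z = exp (deriv h 0 * z + quad_coeff h * z\<^sup>2 + e) \<and> norm e \<le> K / R * norm z ^ 3)"
      using K(2)[OF R(1)] by blast
    then obtain e where e: "h (of_real x) = exp (deriv h 0 * of_real x + quad_coeff h * (of_real x)\<^sup>2 + e)"
      "norm e \<le> K / R * \<bar>x\<bar> ^ 3" using h(4)[of "of_real x"] R by auto
    have d: "deriv g 0 = deriv h 0" "quad_coeff g = quad_coeff h + of_real (sum_list bs)"
      using deriv_quad_prod[OF lee_yangD(1,2)[OF h(1)] h(3)] by auto
    have "norm (g (of_real x)) \<le> exp (sum_list bs * x\<^sup>2) * norm (h (of_real x))"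
      unfolding h(3) norm_mult by (intro mult_right_mono norm_quad_prod_le_exp h) auto
    also have "norm (h (of_real x)) = exp (Re (deriv h 0) * x + Re (quad_coeff h) * x\<^sup>2 + Re e)"
      unfolding e(1) by (simp add: norm_exp_eq_Re flip: of_real_power)
    also have "exp (sum_list bs * x\<^sup>2) * \<dots> = exp (?A + Re e)"
      by (simp add: d exp_add[symmetric] algebra_simps)
    also have "\<dots> \<le> exp (?A + K * \<bar>x\<bar> ^ 3 / R)"
      using e(2) abs_Re_le_cmod[of e] by simp
    finally show ?thesis .
  qed
  show ?thesis
  proof (rule tendsto_lowerbound)
    have "((\<lambda>R. exp (?A + K * \<bar>x\<bar> ^ 3 / R)) \<longlongrightarrow> exp (?A + 0)) at_top"
      by (intro tendsto_intros tendsto_divide_0[OF tendsto_const] filterlim_at_top_imp_at_infinity filterlim_ident)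
    then show "((\<lambda>R. exp (?A + K * \<bar>x\<bar> ^ 3 / R)) \<longlongrightarrow> exp ?A) at_top" by simp
    show "\<forall>\<^sub>F R in at_top. norm (g (of_real x)) \<le> exp (?A + K * \<bar>x\<bar> ^ 3 / R)"
      using eventually_ge_at_top[of 1] eventually_ge_at_top[of "4 * \<bar>x\<bar>"]
      by eventually_elim (rule le)
  qed auto
qed

lemma quad_prod_exp_decay:
  assumes "\<delta> > 0"
  shows "((\<lambda>x. norm (quad_prod bs (of_real x)) * exp (- \<delta> * x\<^sup>2)) \<longlongrightarrow> 0) at_top"
  using assms
proof (induction bs arbitrary: \<delta>)
  case Nil
  have "((\<lambda>x::real. exp (- \<delta> * x\<^sup>2)) \<longlongrightarrow> 0) at_top" using Nil by real_asymp
  then show ?case by simp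
next
  case (Cons b bs)
  have "((\<lambda>x. (1 + b * x\<^sup>2) * exp (- (\<delta> / 2) * x\<^sup>2)) \<longlongrightarrow> 0) at_top"
    using Cons.prems by real_asymp
  from tendsto_rabs_zero[OF this]
  have "((\<lambda>x. \<bar>1 + b * x\<^sup>2\<bar> * exp (- (\<delta> / 2) * x\<^sup>2)) \<longlongrightarrow> 0) at_top"
    by (simp add: abs_mult)
  from tendsto_mult[OF this Cons.IH[of "\<delta> / 2"]] Cons.prems
  have "((\<lambda>x. (\<bar>1 + b * x\<^sup>2\<bar> * exp (- (\<delta> / 2) * x\<^sup>2)) *
     (norm (quad_prod bs (of_real x)) * exp (- (\<delta> / 2) * x\<^sup>2))) \<longlongrightarrow> 0) at_top" by simp
  moreover have "(\<bar>1 + b * x\<^sup>2\<bar> * exp (- (\<delta> / 2) * x\<^sup>2)) *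
     (norm (quad_prod bs (of_real x)) * exp (- (\<delta> / 2) * x\<^sup>2)) =
     norm (quad_prod (b # bs) (of_real x)) * exp (- \<delta> * x\<^sup>2)" for x
  proof -
    have "norm (1 + of_real b * (of_real x)\<^sup>2 :: complex) = norm (of_real (1 + b * x\<^sup>2) :: complex)" by simp
    then have "norm (1 + of_real b * (of_real x)\<^sup>2 :: complex) = \<bar>1 + b * x\<^sup>2\<bar>"
      by (simp only: norm_of_real)
    moreover have "exp (- \<delta> * x\<^sup>2) = exp (- (\<delta> / 2) * x\<^sup>2) * exp (- (\<delta> / 2) * x\<^sup>2)"
      by (simp flip: exp_add)
    ultimately show ?thesis by (simp add: norm_mult)
  qed
  ultimately show ?case by simp
qed

text \<open>
  If the coefficient were negative, the Gaussian decay of the cofactor along the real axis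
  would beat the polynomial \<open>quad_prod bs\<close>, against the assumed lower bound (which, for a moment
  generating function, is Jensen's inequality).
\<close>

lemma quad_coeff_cofactor_nonneg:
  assumes f: "\<And>x. norm (f (of_real x)) \<ge> exp (Re (deriv f 0) * x)"
    and g: "lee_yang g" "\<And>z. f z = quad_prod bs z * g z"
  shows "Re (quad_coeff g) \<ge> 0"
proof (rule ccontr)
  assume "\<not> Re (quad_coeff g) \<ge> 0"
  then have neg: "- Re (quad_coeff g) > 0" by simp
  have d: "deriv f 0 = deriv g 0"
    using deriv_quad_prod[OF lee_yangD(1,2)[OF g(1)] g(2)] by auto
  have "1 \<le> norm (quad_prod bs (of_real x)) * exp (- (- Re (quad_coeff g)) * x\<^sup>2)" for x
  proof -
    have "exp (Re (deriv g 0) * x) \<le> norm (quad_prod bs (of_real x)) * norm (g (of_real x))"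
      using f[of x] by (simp add: g(2) d norm_mult)
    also have "\<dots> \<le> norm (quad_prod bs (of_real x)) * exp (Re (deriv g 0) * x + Re (quad_coeff g) * x\<^sup>2)"
      by (intro mult_left_mono lee_yang_real_bound g) auto
    finally show ?thesis by (simp add: exp_add)
  qed
  then have "1 \<le> (0::real)"
    by (intro tendsto_lowerbound[OF quad_prod_exp_decay[OF neg, of bs]]) auto
  then show False by simp
qed

section \<open>Approximation by polynomial factors\<close>

lemma exp_power_approx:
  fixes u :: complex
  assumes "n > 0"
  shows "norm (exp u - (1 + u / of_nat n) ^ n) \<le> exp (norm u) * (norm u)\<^sup>2 / real n"
proof -
  define r where "r = norm u / real n"
  define z where "z = exp (u / of_nat n) / of_real (exp r)"
  define w where "w = (1 + u / of_nat n) / of_real (exp r)"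
  have r: "norm (u / of_nat n) = r" "norm u = real n * r"
    using assms by (simp_all add: r_def norm_divide)
  have z: "norm z \<le> 1"
  proof -
    have "Re (u / of_nat n) \<le> r" using complex_Re_le_cmod[of "u / of_nat n"] r by simp
    then show ?thesis by (simp add: z_def norm_divide)
  qed
  have w: "norm w \<le> 1"
  proof -
    have "norm (1 + u / of_nat n) \<le> 1 + r"
      using norm_triangle_ineq[of 1 "u / of_nat n"] unfolding r by simp
    also have "\<dots> \<le> exp r" by (rule exp_ge_add_one_self)
    finally show ?thesis by (simp add: w_def norm_divide)
  qed
  have er: "(of_real (exp r) :: complex) ^ n = of_real (exp (norm u))"
    using r(2) by (simp add: exp_of_nat_mult flip: of_real_power)
  have "(exp (u / of_nat n)) ^ n = exp u"
    using assms by (simp flip: exp_of_nat_mult)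
  then have "exp u - (1 + u / of_nat n) ^ n = of_real (exp (norm u)) * (z ^ n - w ^ n)"
    by (simp add: z_def w_def power_divide er right_diff_distrib)
  then have "norm (exp u - (1 + u / of_nat n) ^ n) = exp (norm u) * norm (z ^ n - w ^ n)"
    by (simp add: norm_mult)
  also have "\<dots> \<le> exp (norm u) * (n * norm (z - w))"
    by (intro mult_left_mono norm_power_diff z w) auto
  also have "norm (z - w) = norm (exp (u / of_nat n) - (1 + u / of_nat n)) / exp r"
    by (simp add: z_def w_def norm_divide flip: diff_divide_distrib)
  also have "norm (exp (u / of_nat n) - (1 + u / of_nat n)) \<le> exp \<bar>Re (u / of_nat n)\<bar> * r\<^sup>2"
    using Taylor_exp[of "u / of_nat n" 1] r by (simp add: power2_eq_square)
  also have "\<dots> \<le> exp r * r\<^sup>2"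
    using abs_Re_le_cmod[of "u / of_nat n"] r by (intro mult_right_mono) auto
  also have "exp (norm u) * (n * (exp r * r\<^sup>2 / exp r)) = exp (norm u) * (norm u)\<^sup>2 / real n"
    using assms r(2) by (simp add: power2_eq_square)
  finally show ?thesis by (simp add: divide_right_mono mult_left_mono)
qed

text \<open>
  In \<open>lee_yang_log_expansion\<close> the error term tends to 0 with growing radius, and the remaining
  Gaussian factor \<open>exp (\<beta> * z\<^sup>2)\<close> is a limit of \<open>(1 + \<beta> * z\<^sup>2 / n) ^ n\<close>. As \<open>\<beta> \<ge> 0\<close>, this is a product
  of factors of the same kind as those carrying the zeros.
\<close>

lemma lee_yang_approx:
  assumes L: "lee_yang f" and a: "deriv f 0 = of_real a" and c: "quad_coeff f \<in> \<real>"
    and ge: "\<And>x. norm (f (of_real x)) \<ge> exp (a * x)" and \<epsilon>: "\<epsilon> > 0"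
  obtains bs where "\<forall>b\<in>set bs. b \<ge> 0"
    "\<And>z. norm z \<le> 1 \<Longrightarrow> norm (f z - exp (of_real a * z) * quad_prod bs z) \<le> \<epsilon>"
proof -
  obtain K where K: "K > 0" "\<And>R. R \<ge> 1 \<Longrightarrow> \<exists>bs g. lee_yang g \<and> (\<forall>b\<in>set bs. b > 0) \<and>
     (\<forall>z. f z = quad_prod bs z * g z) \<and>
     (\<forall>z. norm z \<le> R / 4 \<longrightarrow>
       (\<exists>e. g z = exp (deriv g 0 * z + quad_coeff g * z\<^sup>2 + e) \<and> norm e \<le> K / R * norm z ^ 3))"
    using lee_yang_log_expansion[OF L] by blast
  obtain C D where CD: "C > 0" "D > 0" "\<And>z. norm (f z) \<le> C * exp (D * (norm z)\<^sup>2)"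
    using L unfolding lee_yang_def by blast
  define B where "B = C * exp D"
  have B: "B > 0" "norm (f z) \<le> B" if "norm z \<le> 1" for z
  proof -
    show "B > 0" using CD by (simp add: B_def)
    have "norm (f z) \<le> C * exp (D * (norm z)\<^sup>2)" by (rule CD)
    also have "\<dots> \<le> C * exp (D * 1)"
      using that CD by (intro mult_left_mono) (auto simp: abs_square_le_1)
    finally show "norm (f z) \<le> B" by (simp add: B_def)
  qed
  have B0: "B > 0" using B(1)[of 0] by simp
  define R where "R = max 4 (max K (6 * B * K / \<epsilon>))"
  have R: "R \<ge> 4" "K / R \<le> 1" "3 * B * (K / R) \<le> \<epsilon> / 2"
  proof -
    show R4: "R \<ge> 4" by (simp add: R_def)
    have "K \<le> R" "6 * B * K / \<epsilon> \<le> R" by (simp_all add: R_def)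
    then show "K / R \<le> 1" "3 * B * (K / R) \<le> \<epsilon> / 2"
      using R4 \<epsilon> by (auto simp: field_simps)
  qed
  obtain bs g where g: "lee_yang g" "\<forall>b\<in>set bs. b > 0" "\<And>z. f z = quad_prod bs z * g z"
    "\<And>z. norm z \<le> R / 4 \<Longrightarrow>
       (\<exists>e. g z = exp (deriv g 0 * z + quad_coeff g * z\<^sup>2 + e) \<and> norm e \<le> K / R * norm z ^ 3)"
    using K(2)[of R] R by auto
  have d: "deriv f 0 = deriv g 0" "quad_coeff f = quad_coeff g + of_real (sum_list bs)"
    using deriv_quad_prod[OF lee_yangD(1,2)[OF g(1)] g(3)] by auto
  define \<beta> where "\<beta> = Re (quad_coeff g)"
  have "quad_coeff g = quad_coeff f - of_real (sum_list bs)" using d by simp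
  with c have "quad_coeff g \<in> \<real>" by simp
  then have qg: "quad_coeff g = of_real \<beta>" by (simp add: \<beta>_def)
  have \<beta>: "\<beta> \<ge> 0"
    unfolding \<beta>_def using ge a by (intro quad_coeff_cofactor_nonneg[OF _ g(1) g(3)]) auto
  define A where "A = (\<lambda>z. exp (of_real a * z) * quad_prod bs z)"
  \<comment> \<open>On the unit disc the error \<open>e\<close> satisfies \<open>norm e \<le> K / R \<le> 1\<close>, so \<open>exp (- e)\<close> is within \<open>3 * K / R\<close> of 1.\<close>
  have 1: "norm (f z - A z * exp (of_real \<beta> * z\<^sup>2)) \<le> \<epsilon> / 2" if z: "norm z \<le> 1" for z
  proof -
    obtain e where e: "g z = exp (deriv g 0 * z + quad_coeff g * z\<^sup>2 + e)" "norm e \<le> K / R * norm z ^ 3"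
      using g(4)[of z] z R by auto
    have "norm z ^ 3 \<le> 1" using z by (simp add: power_le_one)
    then have "K / R * norm z ^ 3 \<le> K / R * 1" using K R by (intro mult_left_mono) auto
    with e(2) have e': "norm e \<le> K / R" by simp
    have "f z = A z * exp (of_real \<beta> * z\<^sup>2) * exp e"
      unfolding g(3) e(1) A_def qg d(1)[symmetric] a by (simp add: exp_add)
    then have "A z * exp (of_real \<beta> * z\<^sup>2) = f z * exp (- e)" by (simp add: exp_minus field_simps)
    then have "f z - A z * exp (of_real \<beta> * z\<^sup>2) = - (f z * (exp (- e) - 1))"
      by (simp add: algebra_simps)
    then have "norm (f z - A z * exp (of_real \<beta> * z\<^sup>2)) = norm (f z) * norm (exp (- e) - 1)"
      by (simp add: norm_mult)
    also have "\<dots> \<le> B * (3 * (K / R))"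
    proof (intro mult_mono B z)
      have "norm (exp (- e) - 1) \<le> exp \<bar>Re e\<bar> * norm e"
        using Taylor_exp[of "- e" 0] by simp
      also have "\<dots> \<le> exp 1 * (K / R)"
        using abs_Re_le_cmod[of e] e' R(2) by (intro mult_mono) auto
      also have "\<dots> \<le> 3 * (K / R)"
        using exp_le K R by (intro mult_right_mono) auto
      finally show "norm (exp (- e) - 1) \<le> 3 * (K / R)" .
    qed (use B0 in auto)
    also have "\<dots> \<le> \<epsilon> / 2" using R(3) by (simp add: mult_ac)
    finally show ?thesis .
  qed
  have "continuous_on (cball 0 1) A"
    unfolding A_def by (intro holomorphic_on_imp_continuous_on holomorphic_intros)
  then have "bounded (A ` cball 0 1)"
    by (intro compact_imp_bounded compact_continuous_image compact_cball)
  then obtain B' where B': "\<And>z. norm z \<le> 1 \<Longrightarrow> norm (A z) \<le> B'"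
    unfolding bounded_iff by (force simp: mem_cball_0)
  have B'0: "B' \<ge> 0" using B'[of 0] order_trans[OF norm_ge_zero[of "A 0"]] by simp
  obtain n :: nat where n: "n > 0" "B' * (exp \<beta> * \<beta>\<^sup>2) / real n \<le> \<epsilon> / 2"
  proof -
    obtain n :: nat where n: "2 * (B' * (exp \<beta> * \<beta>\<^sup>2)) / \<epsilon> < real n"
      using reals_Archimedean2 by blast
    moreover have "0 \<le> 2 * (B' * (exp \<beta> * \<beta>\<^sup>2)) / \<epsilon>" using B'0 \<epsilon> by simp
    ultimately have "0 < n" by (metis of_nat_0_less_iff order.strict_trans1)
    then show ?thesis using n \<epsilon> by (intro that[of n]) (auto simp: field_simps)
  qed
  have 2: "norm (A z * exp (of_real \<beta> * z\<^sup>2) - A z * (1 + of_real (\<beta> / n) * z\<^sup>2) ^ n) \<le> \<epsilon> / 2"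
    if z: "norm z \<le> 1" for z
  proof -
    let ?u = "of_real \<beta> * z\<^sup>2"
    have u: "norm ?u \<le> \<beta>"
    proof -
      have "(norm z)\<^sup>2 \<le> 1" using z by (simp add: abs_square_le_1)
      then have "\<beta> * (norm z)\<^sup>2 \<le> \<beta> * 1" using \<beta> by (intro mult_left_mono)
      then show ?thesis using \<beta> by (simp add: norm_mult norm_power)
    qed
    have "norm (A z * exp ?u - A z * (1 + of_real (\<beta> / n) * z\<^sup>2) ^ n)
        = norm (A z) * norm (exp ?u - (1 + ?u / of_nat n) ^ n)"
      by (simp flip: right_diff_distrib norm_mult)
    also have "\<dots> \<le> B' * (exp (norm ?u) * (norm ?u)\<^sup>2 / real n)"
      by (intro mult_mono B' exp_power_approx z n B'0) auto
    also have "\<dots> \<le> B' * (exp \<beta> * \<beta>\<^sup>2 / real n)"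
      using u by (intro mult_left_mono divide_right_mono mult_mono power_mono B'0) auto
    also have "\<dots> \<le> \<epsilon> / 2" using n by simp
    finally show ?thesis .
  qed
  show ?thesis
  proof (rule that)
    show "\<forall>b\<in>set (replicate n (\<beta> / n) @ bs). b \<ge> 0" using g(2) \<beta> by (auto simp: less_imp_le)
    fix z :: complex assume z: "norm z \<le> 1"
    have "f z - exp (of_real a * z) * quad_prod (replicate n (\<beta> / n) @ bs) z
      = (f z - A z * exp (of_real \<beta> * z\<^sup>2)) + (A z * exp (of_real \<beta> * z\<^sup>2) - A z * (1 + of_real (\<beta> / n) * z\<^sup>2) ^ n)"
      by (simp add: A_def mult_ac del: times_divide_eq_left)
    then show "norm (f z - exp (of_real a * z) * quad_prod (replicate n (\<beta> / n) @ bs) z) \<le> \<epsilon>"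
      using norm_triangle_mono[OF 1[OF z] 2[OF z]] by (simp only: field_sum_of_halves)
  qed
qed

section \<open>Log-concavity of the even moments\<close>

text \<open>
  The last condition excludes internal zeros, without which log-concavity does not give
  \<open>log_concave_seq_step2\<close>.
\<close>

definition log_concave_seq :: "(nat \<Rightarrow> real) \<Rightarrow> bool" where
  "log_concave_seq c \<longleftrightarrow> (\<forall>k. 0 \<le> c k) \<and> (\<forall>k. c k * c (k + 2) \<le> (c (k + 1))\<^sup>2) \<and>
     (\<forall>k. c k = 0 \<longrightarrow> c (k + 1) = 0)"

lemma log_concave_seq_step2:
  assumes "log_concave_seq c"
  shows "c k * c (k + 3) \<le> c (k + 1) * c (k + 2)"
proof (cases "c (k + 3) = 0")
  case True
  then show ?thesis using assms by (simp add: log_concave_seq_def)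
next
  case False
  have c: "0 \<le> c k" "c k * c (k + 2) \<le> (c (k + 1))\<^sup>2" "c k = 0 \<longrightarrow> c (k + 1) = 0" for k
    using assms by (auto simp: log_concave_seq_def)
  have n2: "c (k + 2) \<noteq> 0" using False c(3)[of "k + 2"] by (auto simp: numeral_3_eq_3)
  then have n1: "c (k + 1) \<noteq> 0" using c(3)[of "k + 1"] by auto
  have pos: "c (k + 1) > 0" "c (k + 2) > 0" using n1 n2 c(1)[of "k + 1"] c(1)[of "k + 2"] by auto
  have "(c k * c (k + 2)) * (c (k + 1) * c (k + 3)) \<le> (c (k + 1))\<^sup>2 * (c (k + 2))\<^sup>2"
    using c(2)[of k] c(2)[of "k + 1"] c(1) by (intro mult_mono) (auto simp: numeral_3_eq_3)
  then have "(c k * c (k + 3)) * (c (k + 1) * c (k + 2)) \<le> (c (k + 1) * c (k + 2)) * (c (k + 1) * c (k + 2))"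
    by (simp add: power2_eq_square mult_ac)
  then show ?thesis using pos by simp
qed

text \<open>
  If \<open>c k = k! * f k\<close> for the coefficients \<open>f k\<close> of a power series in \<open>w\<close>, then the new sequence
  belongs in the same way to the product with \<open>1 + b * w\<close>. The difference of the two sides of the new
  inequality is a polynomial in \<open>b\<close> with nonnegative coefficients; this is the limiting case of
  Newton's inequalities, proved one linear factor at a time.
\<close>

lemma log_concave_seq_linear_factor:
  assumes c: "log_concave_seq c" and b: "b \<ge> 0"
  shows "log_concave_seq (\<lambda>k. c k + b * real k * c (k - 1))"
proof -
  have c1: "0 \<le> c k" "c k * c (k + 2) \<le> (c (k + 1))\<^sup>2" "c k = 0 \<Longrightarrow> c (k + 1) = 0" for k
    using c by (auto simp: log_concave_seq_def)
  let ?d = "\<lambda>k. c k + b * real k * c (k - 1)"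
  have "?d k * ?d (k + 2) \<le> (?d (k + 1))\<^sup>2" for k
  proof (cases k)
    case 0
    have "c 0 * c 2 \<le> (c 1)\<^sup>2" using c1(2)[of 0] by (simp add: numeral_2_eq_2)
    moreover have "0 \<le> b\<^sup>2 * (c 0)\<^sup>2" by simp
    ultimately show ?thesis unfolding 0
      by (simp add: power2_eq_square algebra_simps numeral_2_eq_2)
  next
    case (Suc j)
    define x where "x = real j"
    have x: "x \<ge> 0" by (simp add: x_def)
    define p q r s where "p = c j" "q = c (j + 1)" "r = c (j + 2)" "s = c (j + 3)"
    have h: "q * s \<le> r\<^sup>2" "p * s \<le> q * r" "p * r \<le> q\<^sup>2" "0 \<le> q" "0 \<le> p" "0 \<le> r" "0 \<le> s"
      using c1(2)[of "j + 1"] c1(2)[of j] log_concave_seq_step2[OF c, of j] c1(1)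
      by (simp_all add: p_q_r_s_def numeral_3_eq_3)
    have "(r + b * (x + 2) * q)\<^sup>2 - (q + b * (x + 1) * p) * (s + b * (x + 3) * r) =
      (r\<^sup>2 - q * s) + b * (x + 1) * (q * r - p * s) + b\<^sup>2 * ((x + 2)\<^sup>2 * (q\<^sup>2 - p * r) + p * r)"
      by (simp add: power2_eq_square algebra_simps)
    also have "\<dots> \<ge> 0" using h x b by (intro add_nonneg_nonneg mult_nonneg_nonneg) auto
    finally have "(q + b * (x + 1) * p) * (s + b * (x + 3) * r) \<le> (r + b * (x + 2) * q)\<^sup>2" by simp
    then show ?thesis unfolding Suc p_q_r_s_def x_def
      by (simp add: numeral_3_eq_3 numeral_2_eq_2 algebra_simps)
  qed
  moreover have "?d (k + 1) = 0" if "?d k = 0" for k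
  proof -
    have "c k = 0" using that c1(1)[of k] c1(1)[of "k - 1"] b
      by (smt (verit) mult_nonneg_nonneg of_nat_0_le_iff)
    then show ?thesis using c1(3)[of k] by simp
  qed
  ultimately show ?thesis
    unfolding log_concave_seq_def using c1(1) b by auto
qed

text \<open>
  The coefficients, in the variable \<open>w = z\<^sup>2\<close>, of \<open>cosh (a * z)\<close>, the even part of \<open>exp (a * z)\<close>.
\<close>

lemma log_concave_seq_cosh:
  "log_concave_seq (\<lambda>k. fact k * a ^ (2 * k) / fact (2 * k))"
proof -
  define c where "c = (\<lambda>k. fact k * a ^ (2 * k) / fact (2 * k))"
  define q where "q = (\<lambda>k. a\<^sup>2 / (2 * (2 * real k + 1)))"
  have step: "c (k + 1) = c k * q k" for k
  proof -
    define x y where "x = real k + 1" and "y = 2 * real k + 1"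
    have f: "fact (2 * (k + 1)) = 2 * x * y * fact (2 * k)" "fact (k + 1) = x * fact k"
      by (simp_all add: x_def y_def algebra_simps)
    have "x \<noteq> 0" unfolding x_def by linarith
    then show ?thesis unfolding c_def q_def f y_def[symmetric] by (simp add: power2_eq_square mult_ac)
  qed
  have nonneg: "0 \<le> c k" for k by (simp add: c_def)
  have "c k * c (k + 2) \<le> (c (k + 1))\<^sup>2" for k
  proof -
    have "c (k + 2) = c (k + 1) * q (k + 1)" using step[of "k + 1"] by simp
    then have "c k * c (k + 2) = (c k * c (k + 1)) * q (k + 1)" by simp
    also have "q (k + 1) \<le> q k" unfolding q_def by (intro divide_left_mono) auto
    then have "(c k * c (k + 1)) * q (k + 1) \<le> (c k * c (k + 1)) * q k"
      by (intro mult_left_mono mult_nonneg_nonneg nonneg)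
    also have "\<dots> = (c (k + 1))\<^sup>2" using step[of k] by (simp add: power2_eq_square)
    finally show ?thesis .
  qed
  moreover have "c (k + 1) = 0" if "c k = 0" for k using step[of k] that by simp
  ultimately have "log_concave_seq c" unfolding log_concave_seq_def using nonneg by blast
  then show ?thesis by (simp add: c_def)
qed

text \<open>
  The factors are even functions of \<open>z\<close>, so multiplication by them acts on the even coefficients
  separately, and a possible mean \<open>a\<close> enters through \<open>cosh\<close> only.
\<close>

lemma exp_quad_prod_coeffs:
  assumes "\<forall>b\<in>set bs. b \<ge> 0"
  shows "\<exists>F c. (\<lambda>z. exp (of_real a * z) * quad_prod bs z) has_fps_expansion F \<and> log_concave_seq c \<and>
           (\<forall>k. fps_nth F (2 * k) = of_real (c k / fact k))"
  using assms
proof (induction bs)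
  case Nil
  have "(\<lambda>z. exp (of_real a * z)) has_fps_expansion fps_exp (of_real a :: complex)"
    by (intro fps_expansion_intros)
  then show ?case using log_concave_seq_cosh[of a]
    by (intro exI[of _ "fps_exp (of_real a)"] exI[of _ "\<lambda>k. fact k * a ^ (2 * k) / fact (2 * k)"]) simp
next
  case (Cons b bs)
  then obtain F c where F: "(\<lambda>z. exp (of_real a * z) * quad_prod bs z) has_fps_expansion F"
    and c: "log_concave_seq c" and Fc: "\<And>k. fps_nth F (2 * k) = of_real (c k / fact k)" by auto
  let ?F = "(1 + fps_const (of_real b) * fps_X ^ 2) * F"
  let ?d = "\<lambda>k. c k + b * real k * c (k - 1)"
  have "(\<lambda>z. (1 + of_real b * z ^ 2) * (exp (of_real a * z) * quad_prod bs z)) has_fps_expansion ?F"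
    by (intro fps_expansion_intros F)
  then have 1: "(\<lambda>z. exp (of_real a * z) * quad_prod (b # bs) z) has_fps_expansion ?F"
    by (simp add: mult_ac)
  have "fps_nth ?F (2 * k) = of_real (?d k / fact k)" for k
  proof (cases k)
    case 0
    then show ?thesis using Fc[of 0] by simp
  next
    case (Suc j)
    have "?F = F + fps_const (of_real b) * (fps_X ^ 2 * F)" by (simp add: algebra_simps)
    then have "fps_nth ?F (2 * k) = fps_nth F (2 * k) + of_real b * fps_nth F (2 * j)"
      by (simp add: fps_X_power_mult_nth Suc)
    also have "\<dots> = of_real (?d k / fact k)"
      unfolding Fc Suc by (simp add: field_simps del: of_nat_Suc)
    finally show ?thesis .
  qed
  with 1 log_concave_seq_linear_factor[OF c, of b] Cons.prems show ?case
    by (intro exI[of _ ?F] exI[of _ ?d]) auto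
qed

text \<open>
  Cauchy's estimate on the unit disc turns the uniform approximation by products into
  convergence of each coefficient, and the inequality passes to the limit. The condition on
  internal zeros need not survive the limit, so only the inequality is asserted.
\<close>

lemma lee_yang_even_coeffs_log_concave:
  assumes L: "lee_yang f" and a: "deriv f 0 = of_real a" and c: "quad_coeff f \<in> \<real>"
    and ge: "\<And>x. norm (f (of_real x)) \<ge> exp (a * x)"
    and m: "\<And>k. (deriv ^^ (2 * k)) f 0 = of_real (m k)"
  defines "u \<equiv> \<lambda>k. fact k * m k / fact (2 * k)"
  shows "u k * u (k + 2) \<le> (u (k + 1))\<^sup>2"
proof -
  have "\<exists>c. log_concave_seq c \<and> (\<forall>k. \<bar>u k - c k\<bar> \<le> \<epsilon> * fact k)" if \<epsilon>: "\<epsilon> > 0" for \<epsilon> :: real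
  proof -
    obtain bs where bs: "\<forall>b\<in>set bs. b \<ge> 0"
      "\<And>z. norm z \<le> 1 \<Longrightarrow> norm (f z - exp (of_real a * z) * quad_prod bs z) \<le> \<epsilon>"
      using lee_yang_approx[OF L a c ge \<epsilon>] by metis
    define p where "p = (\<lambda>z. exp (of_real a * z) * quad_prod bs z)"
    obtain F c where F: "p has_fps_expansion F" "log_concave_seq c"
      "\<And>k. fps_nth F (2 * k) = of_real (c k / fact k)"
      using exp_quad_prod_coeffs[OF bs(1)] unfolding p_def by blast
    have p: "p holomorphic_on UNIV" unfolding p_def by (intro holomorphic_intros)
    have fh: "f holomorphic_on UNIV" using lee_yangD L by blast
    have "\<bar>u k - c k\<bar> \<le> \<epsilon> * fact k" for k
    proof -
      have "(deriv ^^ (2 * k)) p 0 = of_real (fact (2 * k) * c k / fact k)"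
      proof -
        have "(deriv ^^ (2 * k)) p 0 = fact (2 * k) * fps_nth F (2 * k)"
          using fps_nth_fps_expansion[OF F(1), of "2 * k"] by simp
        then show ?thesis unfolding F(3) by simp
      qed
      then have "(deriv ^^ (2 * k)) (\<lambda>z. f z - p z) 0 = of_real (m k - fact (2 * k) * c k / fact k)"
        using higher_deriv_diff[OF fh p open_UNIV UNIV_I, of "2 * k" 0] m by simp
      moreover have "norm ((deriv ^^ (2 * k)) (\<lambda>z. f z - p z) 0) \<le> fact (2 * k) * \<epsilon> / 1 ^ (2 * k)"
      proof (rule Cauchy_inequality)
        have d: "(\<lambda>z. f z - p z) holomorphic_on UNIV" by (intro holomorphic_intros fh p)
        then show "(\<lambda>z. f z - p z) holomorphic_on ball 0 1" using holomorphic_on_subset by blast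
        show "continuous_on (cball 0 1) (\<lambda>z. f z - p z)"
          using d holomorphic_on_imp_continuous_on continuous_on_subset by blast
        show "norm (f z - p z) \<le> \<epsilon>" if "norm (0 - z) = 1" for z
          using bs(2)[of z] that by (simp add: p_def)
      qed auto
      ultimately have 1: "\<bar>m k - fact (2 * k) * c k / fact k\<bar> \<le> fact (2 * k) * \<epsilon>"
        by (simp only: norm_of_real) simp
      have "\<bar>u k - c k\<bar> = \<bar>fact k / fact (2 * k) * (m k - fact (2 * k) * c k / fact k)\<bar>"
        by (rule arg_cong[where f = abs]) (simp add: u_def field_simps)
      also have "\<dots> = fact k / fact (2 * k) * \<bar>m k - fact (2 * k) * c k / fact k\<bar>"
        by (simp add: abs_mult)
      also have "\<dots> \<le> fact k / fact (2 * k) * (fact (2 * k) * \<epsilon>)"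
        by (intro mult_left_mono 1) auto
      finally show ?thesis by (simp add: mult.commute)
    qed
    with F(2) show ?thesis by blast
  qed
  from this[of "1 / real (Suc n)" for n]
  obtain d where d: "\<And>n. log_concave_seq (d n)" "\<And>n k. \<bar>u k - d n k\<bar> \<le> 1 / real (Suc n) * fact k"
    by (metis zero_less_divide_1_iff of_nat_0_less_iff zero_less_Suc)
  have lim: "(\<lambda>n. d n k) \<longlonglongrightarrow> u k" for k
  proof (rule LIM_zero_cancel, rule Lim_null_comparison)
    show "\<forall>\<^sub>F n in sequentially. norm (d n k - u k) \<le> 1 / real (Suc n) * fact k"
      using d(2)[of k] by (auto simp: abs_minus_commute)
    have "(\<lambda>n. 1 / real (Suc n) * fact k) \<longlonglongrightarrow> 0 * fact k"
      by (intro tendsto_intros LIMSEQ_Suc[OF lim_1_over_n])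
    then show "(\<lambda>n. 1 / real (Suc n) * fact k) \<longlonglongrightarrow> 0" by simp
  qed
  show ?thesis
    using d(1) by (intro LIMSEQ_le[OF tendsto_mult[OF lim lim] tendsto_power[OF lim]])
      (auto simp: log_concave_seq_def)
qed

text \<open>
  Log-concavity with \<open>u 0 = 1\<close> implies that \<open>ln (u k) / k\<close> is nonincreasing; the form without
  logarithms also covers vanishing terms.
\<close>

lemma log_concave_power_chain:
  fixes u :: "nat \<Rightarrow> real"
  assumes u0: "u 0 = 1" and nn: "\<And>k. u k \<ge> 0" and lc: "\<And>k. u k * u (k + 2) \<le> (u (k + 1))\<^sup>2"
    and z: "\<And>k. 0 < k \<Longrightarrow> u k = 0 \<Longrightarrow> u (k + 1) = 0" and kl: "0 < k" "k \<le> l"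
  shows "u l ^ k \<le> u k ^ l"
proof -
  have step: "u (k + 1) ^ k \<le> u k ^ (k + 1)" for k
  proof (induction k)
    case 0
    then show ?case by (simp add: u0)
  next
    case (Suc k)
    show ?case
    proof (cases "u (k + 1) = 0")
      case True
      then show ?thesis using z[of "k + 1"] by simp
    next
      case False
      then have pos: "u (k + 1) > 0" using nn[of "k + 1"] by simp
      have "u (k + 2) ^ (k + 1) * u (k + 1) ^ k \<le> u (k + 2) ^ (k + 1) * u k ^ (k + 1)"
        using Suc.IH nn by (intro mult_left_mono) auto
      also have "\<dots> = (u k * u (k + 2)) ^ (k + 1)"
        unfolding power_mult_distrib by (simp only: mult.commute)
      also have "\<dots> \<le> ((u (k + 1))\<^sup>2) ^ (k + 1)" using lc nn by (intro power_mono) auto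
      also have "\<dots> = u (k + 1) ^ (k + 2) * u (k + 1) ^ k"
        unfolding power_mult[symmetric] power_add[symmetric] by (rule arg_cong[where f = "\<lambda>n. u (k + 1) ^ n"]) simp
      finally have "u (k + 2) ^ (k + 1) \<le> u (k + 1) ^ (k + 2)"
        using pos by (simp only: mult_le_cancel_right_pos zero_less_power)
      then show ?thesis by simp
    qed
  qed
  show ?thesis using kl(2)
  proof (induction l rule: dec_induct)
    case (step l)
    have "(u (l + 1) ^ k) ^ l = (u (l + 1) ^ l) ^ k" by (simp add: mult.commute flip: power_mult)
    also have "\<dots> \<le> (u l ^ (l + 1)) ^ k" using \<open>\<And>k. u (k + 1) ^ k \<le> u k ^ (k + 1)\<close> nn by (intro power_mono) auto
    also have "\<dots> = (u l ^ k) ^ (l + 1)" by (simp only: mult.commute flip: power_mult)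
    also have "\<dots> \<le> (u k ^ l) ^ (l + 1)" using step.IH nn by (intro power_mono) auto
    also have "\<dots> = (u k ^ (l + 1)) ^ l" by (simp only: mult.commute flip: power_mult)
    finally show ?case using kl step.hyps nn power_mono_iff[of "u (Suc l) ^ k" "u k ^ Suc l" l] by simp
  qed simp
qed

section \<open>Comparison of moments for real variables\<close>

text \<open>
  The moment of order \<open>2 * k\<close> of a standard Gaussian variable.
\<close>

definition gauss_moment :: "nat \<Rightarrow> real" where
  "gauss_moment k = fact (2 * k) / (2 ^ k * fact k)"

lemma gauss_moment_pos: "gauss_moment k > 0"
  by (simp add: gauss_moment_def)

lemma partial_exp_sum_le:
  fixes x :: real
  assumes "x \<ge> 0"
  shows "(\<Sum>i<n. x ^ i / fact i) \<le> exp x"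
proof -
  have sums: "(\<lambda>i. x ^ i / fact i) sums exp x"
    using exp_converges[of x] by (simp add: divide_inverse mult.commute)
  have "(\<Sum>i<n. x ^ i / fact i) \<le> (\<Sum>i. x ^ i / fact i)"
    using assms by (intro sum_le_suminf sums_summable[OF sums]) auto
  then show ?thesis using sums_unique[OF sums] by simp
qed

context prob_space
begin

lemma type_L'_integrable_exp_abs:
  assumes "type_L' M S" "t \<ge> 0"
  shows "integrable M (\<lambda>\<omega>. exp (t * \<bar>S \<omega>\<bar>))"
proof (rule Bochner_Integration.integrable_bound)
  have [measurable]: "S \<in> borel_measurable M" using assms by (simp add: type_L'_def)
  have int: "integrable M (\<lambda>\<omega>. exp (s * S \<omega>))" for s
  proof -
    have "integrable M (\<lambda>\<omega>. exp (of_real s * of_real (S \<omega>) :: complex))"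
      using assms by (simp add: type_L'_def)
    then have "integrable M (\<lambda>\<omega>. of_real (exp (s * S \<omega>)) :: complex)"
      by (simp flip: exp_of_real)
    then show ?thesis by (simp only: complex_of_real_integrable_eq)
  qed
  show "integrable M (\<lambda>\<omega>. exp (t * S \<omega>) + exp ((- t) * S \<omega>))"
    by (intro Bochner_Integration.integrable_add int)
  show "AE \<omega> in M. norm (exp (t * \<bar>S \<omega>\<bar>)) \<le> norm (exp (t * S \<omega>) + exp ((- t) * S \<omega>))"
  proof (rule AE_I2)
    fix \<omega>
    have "exp (t * \<bar>S \<omega>\<bar>) \<le> exp (t * S \<omega>) + exp ((- t) * S \<omega>)"
      by (cases "S \<omega> \<ge> 0") (auto simp: abs_if)
    then show "norm (exp (t * \<bar>S \<omega>\<bar>)) \<le> norm (exp (t * S \<omega>) + exp ((- t) * S \<omega>))"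
      by simp
  qed
  show "(\<lambda>\<omega>. exp (t * \<bar>S \<omega>\<bar>)) \<in> borel_measurable M" by measurable
qed

lemma type_L'_integrable_power:
  assumes "type_L' M S"
  shows "integrable M (\<lambda>\<omega>. S \<omega> ^ n)"
proof (rule Bochner_Integration.integrable_bound)
  have [measurable]: "S \<in> borel_measurable M" using assms by (simp add: type_L'_def)
  show "(\<lambda>\<omega>. S \<omega> ^ n) \<in> borel_measurable M" by measurable
  show "integrable M (\<lambda>\<omega>. fact n * exp (1 * \<bar>S \<omega>\<bar>))"
    by (intro integrable_mult_right type_L'_integrable_exp_abs assms) auto
  have "\<bar>x\<bar> ^ n \<le> fact n * exp \<bar>x\<bar>" for x :: real
  proof -
    have "\<bar>x\<bar> ^ n / fact n \<le> (\<Sum>i<Suc n. \<bar>x\<bar> ^ i / fact i)"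
      by (simp add: sum_nonneg)
    also have "\<dots> \<le> exp \<bar>x\<bar>" by (rule partial_exp_sum_le) simp
    finally show ?thesis by (simp add: field_simps)
  qed
  then show "AE \<omega> in M. norm (S \<omega> ^ n) \<le> norm (fact n * exp (1 * \<bar>S \<omega>\<bar>))"
    by (simp add: power_abs)
qed

lemma moment_fun_sums:
  assumes S: "type_L' M S"
  shows "(\<lambda>n. of_real (expectation (\<lambda>\<omega>. S \<omega> ^ n) / fact n) * z ^ n) sums moment_fun M S z"
proof -
  have [measurable]: "S \<in> borel_measurable M" using S by (simp add: type_L'_def)
  define f :: "nat \<Rightarrow> 'a \<Rightarrow> complex" where "f = (\<lambda>n \<omega>. (z ^ n / fact n) * of_real (S \<omega> ^ n))"
  have f_sums: "(\<lambda>n. f n \<omega>) sums exp (z * of_real (S \<omega>))" for \<omega>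
    using exp_converges[of "z * of_real (S \<omega>)"]
    by (simp add: f_def power_mult_distrib scaleR_conv_of_real divide_inverse mult_ac)
  have norm_f: "norm (f n \<omega>) = (norm z * \<bar>S \<omega>\<bar>) ^ n / fact n" for n \<omega>
    by (simp add: f_def norm_mult norm_divide norm_power power_mult_distrib power_abs)
  have int: "integrable M (f n)" for n
    unfolding f_def by (intro integrable_mult_right integrable_of_real type_L'_integrable_power S)
  have "(\<lambda>n. integral\<^sup>L M (f n)) sums (\<integral>\<omega>. (\<Sum>n. f n \<omega>) \<partial>M)"
  proof (rule sums_integral[OF int])
    show "AE \<omega> in M. summable (\<lambda>n. norm (f n \<omega>))"
      unfolding norm_f using summable_exp[of "norm z * \<bar>S \<omega>\<bar>" for \<omega>]
      by (simp add: divide_inverse mult.commute)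
    show "summable (\<lambda>n. \<integral>\<omega>. norm (f n \<omega>) \<partial>M)"
    proof (rule summableI_nonneg_bounded)
      fix n
      have "(\<Sum>i<n. \<integral>\<omega>. norm (f i \<omega>) \<partial>M) = (\<integral>\<omega>. (\<Sum>i<n. norm (f i \<omega>)) \<partial>M)"
        by (intro Bochner_Integration.integral_sum[symmetric] integrable_norm int)
      also have "\<dots> \<le> (\<integral>\<omega>. exp (norm z * \<bar>S \<omega>\<bar>) \<partial>M)"
        by (intro integral_mono Bochner_Integration.integrable_sum integrable_norm int
            type_L'_integrable_exp_abs S) (auto simp: norm_f intro!: partial_exp_sum_le)
      finally show "(\<Sum>i<n. \<integral>\<omega>. norm (f i \<omega>) \<partial>M) \<le> (\<integral>\<omega>. exp (norm z * \<bar>S \<omega>\<bar>) \<partial>M)" .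
    qed simp
  qed
  also have "(\<integral>\<omega>. (\<Sum>n. f n \<omega>) \<partial>M) = moment_fun M S z"
    unfolding moment_fun_def using f_sums by (simp add: sums_iff)
  also have "(\<lambda>n. integral\<^sup>L M (f n)) = (\<lambda>n. of_real (expectation (\<lambda>\<omega>. S \<omega> ^ n) / fact n) * z ^ n)"
    unfolding f_def by (rule ext) (simp add: integral_complex_of_real del: of_real_power)
  finally show ?thesis .
qed

lemma moment_fun_higher_deriv:
  assumes S: "type_L' M S"
  shows "(deriv ^^ n) (moment_fun M S) 0 = of_real (expectation (\<lambda>\<omega>. S \<omega> ^ n))"
proof -
  let ?F = "Abs_fps (\<lambda>n. of_real (expectation (\<lambda>\<omega>. S \<omega> ^ n) / fact n) :: complex)"
  have "moment_fun M S has_fps_expansion ?F"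
    using moment_fun_sums[OF S] by (intro has_fps_expansionI) simp
  from fps_nth_fps_expansion[OF this, of n] show ?thesis by simp
qed

lemma moment_fun_holomorphic:
  assumes S: "type_L' M S"
  shows "moment_fun M S holomorphic_on A"
proof -
  have "moment_fun M S field_differentiable (at z)" for z
  proof -
    have "moment_fun M S holomorphic_on ball 0 (norm z + 1)"
      using moment_fun_sums[OF S] by (intro power_series_holomorphic[where a = "\<lambda>n. of_real (expectation (\<lambda>\<omega>. S \<omega> ^ n) / fact n)"]) simp
    then show ?thesis
      by (rule holomorphic_on_imp_differentiable_at) auto
  qed
  then show ?thesis by (simp add: holomorphic_on_def field_differentiable_at_within)
qed

lemma moment_fun_lee_yang:
  assumes S: "type_L' M S"
  shows "lee_yang (moment_fun M S)"
proof -
  have "moment_fun M S 0 = 1" by (simp add: moment_fun_def prob_space)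
  moreover have "moment_fun M S (cnj z) = cnj (moment_fun M S z)" for z
    unfolding moment_fun_def
    by (subst Bochner_Integration.integral_cnj[symmetric]) (simp add: exp_cnj del: Bochner_Integration.integral_cnj)
  ultimately show ?thesis
    using S moment_fun_holomorphic[OF S] unfolding lee_yang_def type_L'_def by blast
qed

text \<open>
  The lower bound is Jensen's inequality; it comes from \<open>1 + t \<le> exp t\<close> for the centred variable.
\<close>

lemma moment_fun_Jensen:
  assumes S: "type_L' M S"
  shows "exp (expectation S * x) \<le> norm (moment_fun M S (of_real x))"
proof -
  have [measurable]: "S \<in> borel_measurable M" using S by (simp add: type_L'_def)
  have "integrable M (\<lambda>\<omega>. exp (of_real x * of_real (S \<omega>) :: complex))"
    using S by (simp add: type_L'_def)
  then have "integrable M (\<lambda>\<omega>. of_real (exp (x * S \<omega>)) :: complex)"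
    by (simp flip: exp_of_real)
  then have int: "integrable M (\<lambda>\<omega>. exp (x * S \<omega>))" by (simp only: complex_of_real_integrable_eq)
  have intS: "integrable M S" using type_L'_integrable_power[OF S, of 1] by simp
  let ?a = "expectation S"
  have "exp (?a * x) = (\<integral>\<omega>. exp (?a * x) * (1 + (x * S \<omega> - x * ?a)) \<partial>M)"
    using intS by (simp add: prob_space)
  also have "\<dots> \<le> expectation (\<lambda>\<omega>. exp (x * S \<omega>))"
  proof (rule integral_mono)
    show "integrable M (\<lambda>\<omega>. exp (?a * x) * (1 + (x * S \<omega> - x * ?a)))" using intS by simp
    show "exp (?a * x) * (1 + (x * S \<omega> - x * ?a)) \<le> exp (x * S \<omega>)" for \<omega>
    proof -
      have "exp (?a * x) * (1 + (x * S \<omega> - x * ?a)) \<le> exp (?a * x) * exp (x * S \<omega> - x * ?a)"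
        by (intro mult_left_mono exp_ge_add_one_self) simp
      also have "\<dots> = exp (x * S \<omega>)" by (simp flip: exp_add)
      finally show ?thesis .
    qed
  qed (rule int)
  also have "\<dots> = Re (moment_fun M S (of_real x))"
  proof -
    have "moment_fun M S (of_real x) = (\<integral>\<omega>. of_real (exp (x * S \<omega>)) \<partial>M)"
      unfolding moment_fun_def by (simp flip: exp_of_real)
    then show ?thesis by (simp only: integral_complex_of_real Re_complex_of_real)
  qed
  also have "\<dots> \<le> norm (moment_fun M S (of_real x))" by (rule complex_Re_le_cmod)
  finally show ?thesis .
qed

text \<open>
  The inequality between the norms \<open>\<parallel>S\<parallel>\<close> of orders \<open>2 * l\<close> and \<open>2 * k\<close>, raised to the power \<open>2 * k * l\<close>.
  Dividing the even moments by the Gaussian ones produces, up to the factor \<open>2 ^ k\<close>, precisely the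
  sequence \<open>k! * E S\<^sup>2\<^sup>k / (2 k)!\<close> that is log-concave.
\<close>

lemma type_L'_moment_comparison:
  assumes S: "type_L' M S" and kl: "0 < k" "k \<le> l"
  shows "(expectation (\<lambda>\<omega>. S \<omega> ^ (2 * l)) / gauss_moment l) ^ k
       \<le> (expectation (\<lambda>\<omega>. S \<omega> ^ (2 * k)) / gauss_moment k) ^ l"
proof -
  have [measurable]: "S \<in> borel_measurable M" using S by (simp add: type_L'_def)
  define m where "m = (\<lambda>k. expectation (\<lambda>\<omega>. S \<omega> ^ (2 * k)))"
  define u where "u = (\<lambda>k. m k / gauss_moment k)"
  define v where "v = (\<lambda>k. fact k * m k / fact (2 * k))"
  have uv: "u k = 2 ^ k * v k" for k by (simp add: u_def v_def gauss_moment_def)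
  have d1: "deriv (moment_fun M S) 0 = of_real (expectation S)"
    using moment_fun_higher_deriv[OF S, of 1] by simp
  have "deriv (deriv (moment_fun M S)) 0 = of_real (expectation (\<lambda>\<omega>. S \<omega> ^ 2))"
    using moment_fun_higher_deriv[OF S, of 2] by (simp add: numeral_2_eq_2)
  with d1 have q: "quad_coeff (moment_fun M S) \<in> \<real>"
    unfolding quad_coeff_def by (simp del: of_real_power)
  have v: "v k * v (k + 2) \<le> (v (k + 1))\<^sup>2" for k
    unfolding v_def
    using lee_yang_even_coeffs_log_concave[OF moment_fun_lee_yang[OF S] d1 q moment_fun_Jensen[OF S], of m k]
      moment_fun_higher_deriv[OF S] by (simp add: m_def)
  have "u k * u (k + 2) \<le> (u (k + 1))\<^sup>2" for k
  proof -
    have "u k * u (k + 2) = (2 ^ (k + 1))\<^sup>2 * (v k * v (k + 2))"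
      by (simp add: uv power2_eq_square)
    also have "\<dots> \<le> (2 ^ (k + 1))\<^sup>2 * (v (k + 1))\<^sup>2" by (intro mult_left_mono v) auto
    finally show ?thesis by (simp add: uv power_mult_distrib)
  qed
  moreover have "u 0 = 1" by (simp add: u_def m_def gauss_moment_def prob_space)
  moreover have "u k \<ge> 0" for k
    by (auto simp: u_def m_def gauss_moment_def intro!: divide_nonneg_nonneg integral_nonneg)
  moreover have "u (k + 1) = 0" if "0 < k" "u k = 0" for k
  proof -
    have "m k = 0" using that by (simp add: u_def gauss_moment_def)
    then have "AE \<omega> in M. S \<omega> ^ (2 * k) = 0"
      unfolding m_def by (subst (asm) integral_nonneg_eq_0_iff_AE) (auto intro: type_L'_integrable_power S)
    then have "AE \<omega> in M. S \<omega> ^ (2 * (k + 1)) = 0" by eventually_elim simp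
    then have "m (k + 1) = 0" unfolding m_def by (intro integral_eq_zero_AE) 
    then show ?thesis by (simp add: u_def)
  qed
  ultimately have "u l ^ k \<le> u k ^ l" using kl by (intro log_concave_power_chain) auto
  then show ?thesis by (simp add: u_def m_def)
qed

text \<open>
  The moment generating function of the sum is the product of those of the summands. A real
  multiple of an argument is purely imaginary only if the argument is, unless the multiple is 0, and
  then the corresponding factor is constant.
\<close>

lemma type_L'_linear_combination:
  fixes X :: "'i \<Rightarrow> 'a \<Rightarrow> real" and a :: "'i \<Rightarrow> real"
  assumes I: "finite I" and ind: "indep_vars (\<lambda>_. borel) X I"
    and L: "\<And>j. j \<in> I \<Longrightarrow> type_L' M (X j)"
  shows "type_L' M (\<lambda>\<omega>. \<Sum>j\<in>I. a j * X j \<omega>)"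
proof -
  let ?S = "\<lambda>\<omega>. \<Sum>j\<in>I. a j * X j \<omega>"
  have meas [measurable]: "X j \<in> borel_measurable M" if "j \<in> I" for j
    using L[OF that] by (simp add: type_L'_def)
  have eq: "exp (z * of_real (?S \<omega>)) = (\<Prod>j\<in>I. exp ((z * of_real (a j)) * of_real (X j \<omega>)))"
    for z :: complex and \<omega>
    using I by (simp add: exp_sum sum_distrib_left mult.assoc)
  have ind': "indep_vars (\<lambda>_. borel) (\<lambda>j \<omega>. exp ((z * of_real (a j)) * of_real (X j \<omega>))) I" for z :: complex
    by (rule indep_vars_compose2[OF ind]) measurable
  have int: "integrable M (\<lambda>\<omega>. exp ((z * of_real (a j)) * of_real (X j \<omega>)))" if "j \<in> I" for j and z :: complex
    using L[OF that] unfolding type_L'_def by blast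
  have prod: "moment_fun M ?S z = (\<Prod>j\<in>I. moment_fun M (X j) (z * of_real (a j)))" for z
    unfolding moment_fun_def eq by (rule indep_vars_lebesgue_integral[OF I ind' int])
  have "integrable M (\<lambda>\<omega>. exp (z * of_real (?S \<omega>)))" for z :: complex
    unfolding eq by (rule indep_vars_integrable[OF I ind' int])
  moreover have "\<exists>C>0. \<exists>C'>0. \<forall>z. norm (moment_fun M ?S z) \<le> C * exp (C' * (norm z)\<^sup>2)"
  proof -
    have "\<forall>j\<in>I. \<exists>C D. C > 0 \<and> D > 0 \<and> (\<forall>z. norm (moment_fun M (X j) z) \<le> C * exp (D * (norm z)\<^sup>2))"
      using L unfolding type_L'_def by blast
    then obtain C D where CD: "\<And>j. j \<in> I \<Longrightarrow> C j > 0 \<and> D j > 0 \<and>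
        (\<forall>z. norm (moment_fun M (X j) z) \<le> C j * exp (D j * (norm z)\<^sup>2))"
      by metis
    have "norm (moment_fun M ?S z) \<le> (\<Prod>j\<in>I. C j) * exp (((\<Sum>j\<in>I. D j * (a j)\<^sup>2) + 1) * (norm z)\<^sup>2)" for z
    proof -
      have "norm (moment_fun M ?S z) = (\<Prod>j\<in>I. norm (moment_fun M (X j) (z * of_real (a j))))"
        by (simp add: prod prod_norm)
      also have "\<dots> \<le> (\<Prod>j\<in>I. C j * exp (D j * (norm (z * of_real (a j)))\<^sup>2))"
        using CD by (intro prod_mono) auto
      also have "\<dots> = (\<Prod>j\<in>I. C j) * exp ((\<Sum>j\<in>I. D j * (a j)\<^sup>2) * (norm z)\<^sup>2)"
        using I by (simp add: prod.distrib exp_sum sum_distrib_left norm_mult power_mult_distrib mult_ac)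
      also have "\<dots> \<le> (\<Prod>j\<in>I. C j) * exp (((\<Sum>j\<in>I. D j * (a j)\<^sup>2) + 1) * (norm z)\<^sup>2)"
        using CD by (intro mult_left_mono prod_nonneg) (auto simp: less_imp_le distrib_right)
      finally show ?thesis .
    qed
    moreover have "(\<Prod>j\<in>I. C j) > 0" using CD by (intro prod_pos) auto
    moreover have "(\<Sum>j\<in>I. D j * (a j)\<^sup>2) + 1 > 0"
      using CD by (intro add_nonneg_pos sum_nonneg mult_nonneg_nonneg) (auto simp: less_imp_le)
    ultimately show ?thesis by blast
  qed
  moreover have "Re z = 0" if z: "moment_fun M ?S z = 0" for z
  proof -
    obtain j where j: "j \<in> I" "moment_fun M (X j) (z * of_real (a j)) = 0"
      using z I unfolding prod by auto
    have "a j \<noteq> 0"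
    proof
      assume "a j = 0"
      then show False using j(2) by (simp add: moment_fun_def prob_space)
    qed
    moreover have "Re (z * of_real (a j)) = 0" using L[OF j(1)] j(2) unfolding type_L'_def by blast
    ultimately show ?thesis by simp
  qed
  ultimately show ?thesis unfolding type_L'_def by simp
qed

end

section \<open>Positive semidefinite quadratic forms\<close>

text \<open>
  Lagrange's completion of squares, one variable at a time. A variable with vanishing
  diagonal coefficient cannot occur in the mixed terms, as the form would be unbounded below.
  Working with the form instead of an orthonormal basis serves real and complex spaces alike.
\<close>

lemma psd_form_sum_of_squares:
  fixes A :: "'i \<Rightarrow> 'i \<Rightarrow> real"
  assumes "finite I" "\<And>i j. A i j = A j i"
    and "\<And>x. 0 \<le> (\<Sum>i\<in>I. \<Sum>j\<in>I. A i j * x i * x j)"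
  shows "\<exists>m (b :: nat \<Rightarrow> 'i \<Rightarrow> real). \<forall>x.
    (\<Sum>i\<in>I. \<Sum>j\<in>I. A i j * x i * x j) = (\<Sum>r<m. (\<Sum>j\<in>I. b r j * x j)\<^sup>2)"
  using assms
proof (induction I arbitrary: A rule: finite_induct)
  case empty
  show ?case by (intro exI[of _ 0]) simp
next
  case (insert p I)
  define L where "L = (\<lambda>x. \<Sum>j\<in>I. A p j * x j)"
  define Q where "Q = (\<lambda>x. \<Sum>i\<in>I. \<Sum>j\<in>I. A i j * x i * x j)"
  define a where "a = A p p"
  have split: "(\<Sum>i\<in>insert p I. \<Sum>j\<in>insert p I. A i j * x i * x j) = a * (x p)\<^sup>2 + 2 * x p * L x + Q x" for x
  proof -
    have "(\<Sum>i\<in>insert p I. \<Sum>j\<in>insert p I. A i j * x i * x j)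
        = a * (x p)\<^sup>2 + (\<Sum>j\<in>I. A p j * x p * x j) + (\<Sum>i\<in>I. A i p * x i * x p) + Q x"
      using insert.hyps by (simp add: a_def Q_def sum.distrib power2_eq_square mult_ac)
    also have "(\<Sum>j\<in>I. A p j * x p * x j) = x p * L x"
      by (simp add: L_def sum_distrib_left mult_ac)
    also have "(\<Sum>i\<in>I. A i p * x i * x p) = x p * L x"
      by (simp add: L_def sum_distrib_left mult_ac insert.prems(1)[of _ p])
    finally show ?thesis by simp
  qed
  have nonneg: "0 \<le> a * t\<^sup>2 + 2 * t * L x + Q x" for t x
  proof -
    let ?y = "x(p := t)"
    have "L ?y = L x" unfolding L_def using insert.hyps by (intro sum.cong) auto
    moreover have "Q ?y = Q x" unfolding Q_def using insert.hyps by (intro sum.cong) auto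
    ultimately show ?thesis using insert.prems(2)[of ?y] unfolding split by (simp only: fun_upd_same)
  qed
  show ?case
  proof (cases "a > 0")
    case True
    let ?A = "\<lambda>i j. A i j - A p i * A p j / a"
    have sq: "(L x)\<^sup>2 = (\<Sum>i\<in>I. \<Sum>j\<in>I. A p i * A p j * x i * x j)" for x
      unfolding power2_eq_square L_def sum_product by (simp add: mult_ac)
    have Q': "(\<Sum>i\<in>I. \<Sum>j\<in>I. ?A i j * x i * x j) = Q x - (L x)\<^sup>2 / a" for x
      unfolding sq Q_def by (simp add: sum_divide_distrib sum_subtractf left_diff_distrib)
    have "\<exists>m (b :: nat \<Rightarrow> 'i \<Rightarrow> real). \<forall>x.
      (\<Sum>i\<in>I. \<Sum>j\<in>I. ?A i j * x i * x j) = (\<Sum>r<m. (\<Sum>j\<in>I. b r j * x j)\<^sup>2)"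
    proof (rule insert.IH)
      show "?A i j = ?A j i" for i j using insert.prems(1)[of i j] by simp
      show "0 \<le> (\<Sum>i\<in>I. \<Sum>j\<in>I. ?A i j * x i * x j)" for x
        using nonneg[of "- L x / a" x] True unfolding Q'
        by (simp add: power2_eq_square field_simps)
    qed
    then obtain m and b :: "nat \<Rightarrow> 'i \<Rightarrow> real" where b:
      "\<And>x. Q x - (L x)\<^sup>2 / a = (\<Sum>r<m. (\<Sum>j\<in>I. b r j * x j)\<^sup>2)"
      unfolding Q' by blast
    define b' where "b' = (\<lambda>r j. if r = m then (if j = p then sqrt a else A p j / sqrt a)
      else if j = p then 0 else b r j)"
    have "(\<Sum>j\<in>insert p I. b' m j * x j) = sqrt a * x p + L x / sqrt a" for x
    proof -
      have "(\<Sum>j\<in>I. b' m j * x j) = (\<Sum>j\<in>I. A p j / sqrt a * x j)"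
        using insert.hyps by (intro sum.cong) (auto simp: b'_def)
      then show ?thesis using insert.hyps
        by (simp add: b'_def L_def sum_divide_distrib)
    qed
    moreover have "(\<Sum>j\<in>insert p I. b' r j * x j) = (\<Sum>j\<in>I. b r j * x j)" if "r < m" for r x
    proof -
      have "(\<Sum>j\<in>I. b' r j * x j) = (\<Sum>j\<in>I. b r j * x j)"
        using insert.hyps that by (intro sum.cong) (auto simp: b'_def)
      then show ?thesis using insert.hyps that by (simp add: b'_def)
    qed
    moreover have "(sqrt a * t + s / sqrt a)\<^sup>2 = a * t\<^sup>2 + 2 * t * s + s\<^sup>2 / a" for t s
      using True by (simp add: power2_sum power_mult_distrib power_divide)
    ultimately have eq: "(\<Sum>r<Suc m. (\<Sum>j\<in>insert p I. b' r j * x j)\<^sup>2) = a * (x p)\<^sup>2 + 2 * x p * L x + Q x" for x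
      using b[of x] by simp
    show ?thesis unfolding split by (rule exI, rule exI, rule allI, rule eq[symmetric])
  next
    case False
    have a0: "a = 0"
      using False nonneg[of 1 "\<lambda>_. 0"] by (simp add: L_def Q_def)
    have L0: "L x = 0" for x
    proof (rule ccontr)
      assume "L x \<noteq> 0"
      then show False using nonneg[of "- (Q x + 1) / (2 * L x)" x] a0 by (simp add: field_simps)
    qed
    have "\<exists>m (b :: nat \<Rightarrow> 'i \<Rightarrow> real). \<forall>x.
      (\<Sum>i\<in>I. \<Sum>j\<in>I. A i j * x i * x j) = (\<Sum>r<m. (\<Sum>j\<in>I. b r j * x j)\<^sup>2)"
      using nonneg[of 0] by (intro insert.IH insert.prems(1)) (simp add: Q_def)
    then obtain m and b :: "nat \<Rightarrow> 'i \<Rightarrow> real" where b: "\<And>x. Q x = (\<Sum>r<m. (\<Sum>j\<in>I. b r j * x j)\<^sup>2)"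
      unfolding Q_def by blast
    define b' where "b' = (\<lambda>r j. if j = p then 0 else b r j)"
    have "(\<Sum>j\<in>insert p I. b' r j * x j) = (\<Sum>j\<in>I. b r j * x j)" for r x
    proof -
      have "(\<Sum>j\<in>I. b' r j * x j) = (\<Sum>j\<in>I. b r j * x j)"
        using insert.hyps by (intro sum.cong) (auto simp: b'_def)
      then show ?thesis using insert.hyps by (simp add: b'_def)
    qed
    then have eq: "a * (x p)\<^sup>2 + 2 * x p * L x + Q x = (\<Sum>r<m. (\<Sum>j\<in>insert p I. b' r j * x j)\<^sup>2)" for x
      by (simp add: a0 L0 b)
    show ?thesis unfolding split by (rule exI, rule exI, rule allI, rule eq)
  qed
qed

section \<open>Gaussian linear forms\<close>

definition gauss_space :: "nat \<Rightarrow> (nat \<Rightarrow> real) measure" where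
  "gauss_space m = PiM {..<m} (\<lambda>_. density lborel std_normal_density)"

lemma prob_space_gauss_space: "prob_space (gauss_space m)"
  unfolding gauss_space_def by (intro prob_space_PiM prob_space_normal_density) auto

lemma gauss_space_measurable_component:
  "i < m \<Longrightarrow> (\<lambda>g. g i) \<in> borel_measurable (gauss_space m)"
proof -
  assume "i < m"
  then have "(\<lambda>g. g i) \<in> measurable (gauss_space m) (density lborel std_normal_density)"
    unfolding gauss_space_def by (intro measurable_component_singleton) auto
  then show ?thesis by (simp cong: measurable_cong_sets)
qed

lemma gauss_space_component:
  assumes "i < m"
  shows "distr (gauss_space m) borel (\<lambda>g. g i) = density lborel std_normal_density"
proof -
  interpret product_prob_space "\<lambda>_::nat. density lborel std_normal_density" "{..<m}"
    by (intro product_prob_spaceI prob_space_normal_density) auto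
  have "distr (gauss_space m) borel (\<lambda>g. g i) = distr (gauss_space m) (density lborel std_normal_density) (\<lambda>g. g i)"
    by (intro distr_cong) auto
  also have "\<dots> = density lborel std_normal_density"
    unfolding gauss_space_def using assms by (intro PiM_component) auto
  finally show ?thesis .
qed

lemma gauss_space_indep:
  assumes "m > 0"
  shows "prob_space.indep_vars (gauss_space m) (\<lambda>_. borel) (\<lambda>i g. g i) {..<m}"
proof -
  interpret prob_space "gauss_space m" by (rule prob_space_gauss_space)
  have "distr (gauss_space m) (\<Pi>\<^sub>M i\<in>{..<m}. borel) (\<lambda>x. \<lambda>i\<in>{..<m}. x i)
    = distr (gauss_space m) (gauss_space m) (\<lambda>x. x)"
  proof (rule distr_cong)
    show "sets (\<Pi>\<^sub>M i\<in>{..<m}. borel) = sets (gauss_space m)"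
      unfolding gauss_space_def by (intro sets_PiM_cong) auto
    show "(\<lambda>i\<in>{..<m}. x i) = x" if "x \<in> space (gauss_space m)" for x
      using that by (auto simp: gauss_space_def space_PiM PiE_def extensional_restrict)
  qed simp
  also have "\<dots> = (\<Pi>\<^sub>M i\<in>{..<m}. distr (gauss_space m) borel (\<lambda>g. g i))"
  proof -
    have "(\<Pi>\<^sub>M i\<in>{..<m}. distr (gauss_space m) borel (\<lambda>g. g i))
        = (\<Pi>\<^sub>M i\<in>{..<m}. density lborel std_normal_density)"
      by (intro PiM_cong) (auto simp: gauss_space_component)
    then show ?thesis by (simp add: gauss_space_def distr_id)
  qed
  finally show ?thesis
    using assms
    by (subst indep_vars_iff_distr_eq_PiM') (auto intro: gauss_space_measurable_component)
qed

text \<open>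
  The linear form is a centred Gaussian variable whose variance is \<open>\<Sum>i<m. (t i)\<^sup>2\<close>, by independence.
  Terms with \<open>t i = 0\<close> are left out first, since they have no density.
\<close>

lemma gauss_space_linear_moment:
  "(\<integral>\<^sup>+g. ennreal ((\<Sum>i<m. g i * t i) ^ (2 * k)) \<partial>gauss_space m)
     = ennreal (gauss_moment k * (\<Sum>i<m. (t i)\<^sup>2) ^ k)"
proof -
  interpret prob_space "gauss_space m" by (rule prob_space_gauss_space)
  define J where "J = {i. i < m \<and> t i \<noteq> 0}"
  define \<sigma> where "\<sigma> = sqrt (\<Sum>i\<in>J. \<bar>t i\<bar>\<^sup>2)"
  have J: "J \<subseteq> {..<m}" "finite J" by (auto simp: J_def)
  have sum1: "(\<Sum>i<m. g i * t i) = (\<Sum>i\<in>J. 0 + t i * g i)" for g :: "nat \<Rightarrow> real"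
    using J by (intro sum.mono_neutral_cong_right) (auto simp: J_def)
  have sum2: "(\<Sum>i<m. (t i)\<^sup>2) = (\<Sum>i\<in>J. \<bar>t i\<bar>\<^sup>2)"
    using J by (intro sum.mono_neutral_cong_right) (auto simp: J_def)
  show ?thesis
  proof (cases "J = {}")
    case True
    then show ?thesis unfolding sum1 sum2
      by (cases k) (simp_all add: gauss_moment_def emeasure_space_1)
  next
    case False
    have m: "m > 0" using False J by (cases m) auto
    have "distributed (gauss_space m) lborel (\<lambda>g. \<Sum>i\<in>J. 0 + t i * g i)
      (normal_density (\<Sum>i\<in>J. 0 + t i * 0) (sqrt (\<Sum>i\<in>J. (\<bar>t i\<bar> * 1)\<^sup>2)))"
    proof (rule sum_indep_normal[OF J(2) False])
      show "indep_vars (\<lambda>i. borel) (\<lambda>i g. 0 + t i * g i) J"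
        by (rule indep_vars_compose2[OF indep_vars_subset[OF gauss_space_indep[OF m] J(1)]]) measurable
      fix i assume i: "i \<in> J"
      show "0 < \<bar>t i\<bar> * 1" using i by (simp add: J_def)
      have "distributed (gauss_space m) lborel (\<lambda>g. g i) std_normal_density"
      proof -
        have "i < m" using i J by auto
        moreover have "distr (gauss_space m) lborel (\<lambda>g. g i) = distr (gauss_space m) borel (\<lambda>g. g i)"
          by (intro distr_cong) auto
        ultimately show ?thesis
          unfolding distributed_def using gauss_space_component[of i m] by (simp add: gauss_space_measurable_component)
      qed
      then show "distributed (gauss_space m) lborel (\<lambda>g. 0 + t i * g i)
          (normal_density (0 + t i * 0) (\<bar>t i\<bar> * 1))"
        using i by (intro normal_density_affine) (auto simp: J_def)
    qed
    then have d: "distributed (gauss_space m) lborel (\<lambda>g. \<Sum>i\<in>J. 0 + t i * g i) (normal_density 0 \<sigma>)"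
      by (simp add: \<sigma>_def)
    have "0 < (\<Sum>i\<in>J. \<bar>t i\<bar>\<^sup>2)"
    proof (intro sum_pos J(2) False)
      show "0 < \<bar>t i\<bar>\<^sup>2" if "i \<in> J" for i using that by (simp add: J_def)
    qed
    then have \<sigma>: "\<sigma> > 0" "\<sigma>\<^sup>2 = (\<Sum>i\<in>J. \<bar>t i\<bar>\<^sup>2)"
      unfolding \<sigma>_def by (simp_all only: real_sqrt_gt_zero real_sqrt_pow2 less_imp_le)
    have "(\<integral>\<^sup>+g. ennreal ((\<Sum>i\<in>J. 0 + t i * g i) ^ (2 * k)) \<partial>gauss_space m)
        = (\<integral>\<^sup>+x. ennreal (normal_density 0 \<sigma> x) * ennreal (x ^ (2 * k)) \<partial>lborel)"
      by (rule distributed_nn_integral[OF d, of "\<lambda>x. ennreal (x ^ (2 * k))", symmetric]) measurable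
    also have "\<dots> = (\<integral>\<^sup>+x. ennreal (normal_density 0 \<sigma> x * (x - 0) ^ (2 * k)) \<partial>lborel)"
      by (simp add: ennreal_mult normal_density_nonneg)
    also have "\<dots> = ennreal (fact (2 * k) / ((2 / \<sigma>\<^sup>2) ^ k * fact k))"
      using normal_moment_even[OF \<sigma>(1), of 0 k]
      by (subst nn_integral_eq_integral) (auto simp: has_bochner_integral_iff normal_density_nonneg)
    also have "fact (2 * k) / ((2 / \<sigma>\<^sup>2) ^ k * fact k) = gauss_moment k * (\<sigma>\<^sup>2) ^ k"
      using \<sigma>(1) by (simp add: gauss_moment_def power_divide field_simps)
    finally show ?thesis unfolding sum1 sum2 \<sigma>(2) .
  qed
qed

section \<open>From real variables to sums of squares\<close>

lemma Young_powers:
  fixes s \<tau> :: real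
  assumes "s \<ge> 0" "\<tau> \<ge> 0" "0 < k" "k < l"
  shows "real l * (s ^ k * \<tau> ^ (l - k)) \<le> real k * s ^ l + real (l - k) * \<tau> ^ l"
proof (cases "s = 0 \<or> \<tau> = 0")
  case True
  then show ?thesis using assms by (auto simp: power_0_left)
next
  case False
  then have pos: "s > 0" "\<tau> > 0" using assms by auto
  have l: "real l > 0" using assms by simp
  have "(s ^ l) powr (real k / real l) * (\<tau> ^ l) powr (real (l - k) / real l)
      \<le> real k / real l * s ^ l + real (l - k) / real l * \<tau> ^ l"
    using assms pos by (intro Youngs_inequality_0) (auto simp: of_nat_diff field_simps)
  moreover have "(s ^ l) powr (real k / real l) = s ^ k" "(\<tau> ^ l) powr (real (l - k) / real l) = \<tau> ^ (l - k)"
    using pos l by (simp_all add: powr_powr flip: powr_realpow)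
  ultimately have "real l * (s ^ k * \<tau> ^ (l - k)) \<le> real l * (real k / real l * s ^ l + real (l - k) / real l * \<tau> ^ l)"
    using l by (intro mult_left_mono) auto
  then show ?thesis using l by (simp add: distrib_left)
qed

text \<open>
  Hoelder's inequality for the measure with density \<open>w\<close>, with integer exponents. Young's
  inequality is integrated with \<open>\<tau> ^ k\<close> chosen as the weighted mean of \<open>s ^ k\<close>.
\<close>

lemma weighted_power_mean:
  fixes s w :: "'a \<Rightarrow> real"
  assumes s: "\<And>x. s x \<ge> 0" and w: "\<And>x. w x \<ge> 0" and kl: "0 < k" "k \<le> l"
    and int: "integrable M w" "integrable M (\<lambda>x. s x ^ k * w x)" "integrable M (\<lambda>x. s x ^ l * w x)"
    and pos: "0 < (\<integral>x. w x \<partial>M)"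
  shows "(\<integral>x. s x ^ k * w x \<partial>M) ^ l \<le> (\<integral>x. s x ^ l * w x \<partial>M) ^ k * (\<integral>x. w x \<partial>M) ^ (l - k)"
proof (cases "k = l")
  case False
  define F T B where "F = (\<integral>x. s x ^ k * w x \<partial>M)" and "T = (\<integral>x. s x ^ l * w x \<partial>M)" and "B = (\<integral>x. w x \<partial>M)"
  have kl': "k < l" using kl False by simp
  have B: "B > 0" using pos by (simp add: B_def)
  have F: "F \<ge> 0" unfolding F_def using s w by (intro Bochner_Integration.integral_nonneg) auto
  define \<tau> where "\<tau> = root k (F / B)"
  have \<tau>: "\<tau> \<ge> 0" "\<tau> ^ k = F / B" using F B kl by (simp_all add: \<tau>_def)
  have "real l * (\<tau> ^ (l - k) * F) = (\<integral>x. real l * \<tau> ^ (l - k) * (s x ^ k * w x) \<partial>M)"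
    by (simp add: F_def)
  also have "\<dots> \<le> (\<integral>x. real k * (s x ^ l * w x) + real (l - k) * \<tau> ^ l * w x \<partial>M)"
  proof (rule integral_mono)
    fix x
    have "(real l * (s x ^ k * \<tau> ^ (l - k))) * w x \<le> (real k * s x ^ l + real (l - k) * \<tau> ^ l) * w x"
      by (intro mult_right_mono Young_powers s \<tau> kl kl' w)
    then show "real l * \<tau> ^ (l - k) * (s x ^ k * w x) \<le> real k * (s x ^ l * w x) + real (l - k) * \<tau> ^ l * w x"
      by (simp add: algebra_simps)
  qed (use int in auto)
  also have "\<dots> = real k * T + real (l - k) * \<tau> ^ l * B"
    using int by (simp add: T_def B_def)
  also have "F = \<tau> ^ k * B" using \<tau> B by simp
  also have "\<tau> ^ (l - k) * (\<tau> ^ k * B) = \<tau> ^ l * B"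
    using kl by (simp flip: power_add mult.assoc)
  finally have "real k * (\<tau> ^ l * B) \<le> real k * T"
    using kl by (simp add: of_nat_diff algebra_simps)
  then have "\<tau> ^ l * B \<le> T" using kl by simp
  then have "(\<tau> ^ l * B) ^ k \<le> T ^ k" using \<tau> B by (intro power_mono) auto
  then have "(\<tau> ^ l * B) ^ k * B ^ (l - k) \<le> T ^ k * B ^ (l - k)" using B by (intro mult_right_mono) auto
  also have "(\<tau> ^ l * B) ^ k * B ^ (l - k) = (\<tau> ^ k) ^ l * (B ^ k * B ^ (l - k))"
    by (simp add: power_mult_distrib mult.commute flip: power_mult)
  also have "B ^ k * B ^ (l - k) = B ^ l" using kl by (simp flip: power_add)
  also have "(\<tau> ^ k) ^ l * B ^ l = F ^ l" using \<tau> B by (simp flip: power_mult_distrib)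
  finally show ?thesis by (simp add: F_def T_def B_def)
qed simp

context prob_space
begin

text \<open>
  For independent standard Gaussian \<open>g\<close>, the real variable \<open>S g = (\<Sum>r<m. g r * Y r)\<close> is of type \<open>\<L>'\<close>, and
  averaging \<open>(S g) ^ (2 * l)\<close> over \<open>g\<close> gives \<open>W ^ l\<close> times a Gaussian moment. So the inequality for real
  variables can be applied for each \<open>g\<close> and averaged. The power \<open>l / k\<close> that appears on the right is
  moved inside the expectation by \<open>weighted_power_mean\<close> with weight \<open>W ^ k\<close> and \<open>s = S\<^sup>2 / W\<close>, whose
  \<open>g\<close>-averages do not depend on \<open>\<omega>\<close>; this is Minkowski's inequality in a form adapted to \<open>W\<close>.
\<close>

lemma sum_of_squares_moment_comparison:
  fixes X :: "'i \<Rightarrow> 'a \<Rightarrow> real" and b :: "nat \<Rightarrow> 'i \<Rightarrow> real" and m :: nat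
  assumes I: "finite I" and ind: "indep_vars (\<lambda>_. borel) X I"
    and L: "\<And>j. j \<in> I \<Longrightarrow> type_L' M (X j)" and kl: "0 < k" "k \<le> l"
  defines "W \<equiv> \<lambda>\<omega>. \<Sum>r<m. (\<Sum>j\<in>I. b r j * X j \<omega>)\<^sup>2"
  shows "(expectation (\<lambda>\<omega>. W \<omega> ^ l) / gauss_moment l) ^ k \<le> (expectation (\<lambda>\<omega>. W \<omega> ^ k) / gauss_moment k) ^ l"
proof -
  define Y where "Y = (\<lambda>r \<omega>. \<Sum>j\<in>I. b r j * X j \<omega>)"
  define S where "S = (\<lambda>g \<omega>. \<Sum>r<m. g r * Y r \<omega>)"
  have LY: "type_L' M (Y r)" for r
    unfolding Y_def by (rule type_L'_linear_combination[OF I ind L])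
  have LS: "type_L' M (S g)" for g
  proof -
    have "S g = (\<lambda>\<omega>. \<Sum>j\<in>I. (\<Sum>r<m. g r * b r j) * X j \<omega>)"
      unfolding S_def Y_def sum_distrib_left sum_distrib_right
      by (rule ext, subst sum.swap) (simp add: mult_ac)
    then show ?thesis using type_L'_linear_combination[OF I ind L] by simp
  qed
  have [measurable]: "Y r \<in> borel_measurable M" "S g \<in> borel_measurable M" for r g
    using LY LS by (simp_all add: type_L'_def)
  have W: "W \<omega> = (\<Sum>r<m. (Y r \<omega>)\<^sup>2)" for \<omega> by (simp add: W_def Y_def)
  have W0: "W \<omega> \<ge> 0" for \<omega> unfolding W by (intro sum_nonneg) auto
  have [measurable]: "W \<in> borel_measurable M" unfolding W[abs_def] by measurable
  have intW: "integrable M (\<lambda>\<omega>. W \<omega> ^ n)" for n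
  proof (rule Bochner_Integration.integrable_bound)
    show "integrable M (\<lambda>\<omega>. real m ^ n * (\<Sum>r<m. Y r \<omega> ^ (2 * n)) + 1)"
      by (intro integrable_mult_right Bochner_Integration.integrable_add Bochner_Integration.integrable_sum
          type_L'_integrable_power LY) simp
    show "AE \<omega> in M. norm (W \<omega> ^ n) \<le> norm (real m ^ n * (\<Sum>r<m. Y r \<omega> ^ (2 * n)) + 1)"
    proof (rule AE_I2)
      fix \<omega>
      have nn: "0 \<le> real m ^ n * (\<Sum>r<m. Y r \<omega> ^ (2 * n))"
        by (intro mult_nonneg_nonneg sum_nonneg) auto
      have "W \<omega> ^ n \<le> real m ^ n * (\<Sum>r<m. Y r \<omega> ^ (2 * n)) + 1"
      proof (cases "m = 0")
        case True
        then show ?thesis using nn by (cases n) (auto simp: W)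
      next
        case False
        define q where "q = (MAX r\<in>{..<m}. (Y r \<omega>)\<^sup>2)"
        have "q \<in> (\<lambda>r. (Y r \<omega>)\<^sup>2) ` {..<m}" unfolding q_def using False by (intro Max_in) auto
        then obtain r where r: "r < m" "q = (Y r \<omega>)\<^sup>2" by auto
        have "W \<omega> \<le> (\<Sum>r<m. q)" unfolding W q_def by (intro sum_mono Max_ge) auto
        then have "W \<omega> ^ n \<le> (real m * q) ^ n" using W0 by (intro power_mono) auto
        also have "\<dots> = real m ^ n * Y r \<omega> ^ (2 * n)"
          by (simp add: power_mult_distrib r(2) power_mult)
        also have "\<dots> \<le> real m ^ n * (\<Sum>r<m. Y r \<omega> ^ (2 * n))"
          using r(1) by (intro mult_left_mono member_le_sum) auto
        finally show ?thesis by simp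
      qed
      then show "norm (W \<omega> ^ n) \<le> norm (real m ^ n * (\<Sum>r<m. Y r \<omega> ^ (2 * n)) + 1)"
        using W0[of \<omega>] nn by simp
    qed
  qed measurable
  define B where "B = expectation (\<lambda>\<omega>. W \<omega> ^ k)"
  have B0: "B \<ge> 0" unfolding B_def using W0 by (intro Bochner_Integration.integral_nonneg) auto
  show ?thesis
  proof (cases "B = 0")
    case True
    then have "AE \<omega> in M. W \<omega> ^ k = 0"
      unfolding B_def by (subst (asm) integral_nonneg_eq_0_iff_AE[OF intW]) (auto simp: W0)
    then have "AE \<omega> in M. W \<omega> ^ l = 0" by eventually_elim (use kl in auto)
    then have "expectation (\<lambda>\<omega>. W \<omega> ^ l) = 0" by (rule integral_eq_zero_AE)
    then show ?thesis using kl B0 gauss_moment_pos[of k]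
      by (simp add: power_0_left B_def)
  next
    case False
    then have B: "B > 0" using B0 by simp
    define \<Gamma> where "\<Gamma> = gauss_space m"
    interpret G: prob_space \<Gamma> unfolding \<Gamma>_def by (rule prob_space_gauss_space)
    interpret P: pair_sigma_finite \<Gamma> M ..
    \<comment> \<open>Where \<open>W\<close> vanishes, so does \<open>S g\<close>, and the quotient is 0.\<close>
    define s where "s = (\<lambda>g \<omega>. (S g \<omega>)\<^sup>2 / W \<omega>)"
    have CS: "(S g \<omega>)\<^sup>2 \<le> (\<Sum>r<m. (g r)\<^sup>2) * W \<omega>" for g \<omega>
      unfolding S_def W by (rule Cauchy_Schwarz_ineq_sum)
    have s: "0 \<le> s g \<omega>" "s g \<omega> \<le> (\<Sum>r<m. (g r)\<^sup>2)" "W \<omega> = 0 \<Longrightarrow> S g \<omega> = 0" for g \<omega>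
    proof -
      show "0 \<le> s g \<omega>" using W0 by (simp add: s_def)
      show "s g \<omega> \<le> (\<Sum>r<m. (g r)\<^sup>2)"
      proof (cases "W \<omega> = 0")
        case True
        then show ?thesis by (simp add: s_def sum_nonneg)
      next
        case False
        then show ?thesis using CS[of g \<omega>] W0[of \<omega>] by (simp add: s_def divide_le_eq)
      qed
      show "S g \<omega> = 0" if "W \<omega> = 0" using CS[of g \<omega>] that by simp
    qed
    have [measurable]: "s g \<in> borel_measurable M" for g unfolding s_def by measurable
    have sk: "s g \<omega> ^ n * W \<omega> ^ n = S g \<omega> ^ (2 * n)" if "n > 0" for n g \<omega>
    proof (cases "W \<omega> = 0")
      case True
      then show ?thesis using s(3)[OF True, of g] that by (simp add: s_def power_0_left)
    next
      case False
      then show ?thesis by (simp add: s_def power_divide power_mult)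
    qed
    have ints: "integrable M (\<lambda>\<omega>. s g \<omega> ^ n * W \<omega> ^ k)" for g n
    proof (rule Bochner_Integration.integrable_bound)
      show "integrable M (\<lambda>\<omega>. (\<Sum>r<m. (g r)\<^sup>2) ^ n * W \<omega> ^ k)" by (intro integrable_mult_right intW)
      show "AE \<omega> in M. norm (s g \<omega> ^ n * W \<omega> ^ k) \<le> norm ((\<Sum>r<m. (g r)\<^sup>2) ^ n * W \<omega> ^ k)"
      proof (rule AE_I2)
        fix \<omega>
        have "s g \<omega> ^ n * W \<omega> ^ k \<le> (\<Sum>r<m. (g r)\<^sup>2) ^ n * W \<omega> ^ k"
          using s W0 by (intro mult_right_mono power_mono) auto
        then show "norm (s g \<omega> ^ n * W \<omega> ^ k) \<le> norm ((\<Sum>r<m. (g r)\<^sup>2) ^ n * W \<omega> ^ k)"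
          using s(1)[of g \<omega>] W0[of \<omega>] by simp
      qed
    qed measurable
    define T where "T = (\<lambda>g. expectation (\<lambda>\<omega>. s g \<omega> ^ l * W \<omega> ^ k))"
    define H where "H = (\<lambda>g. expectation (\<lambda>\<omega>. S g \<omega> ^ (2 * l)))"
    \<comment> \<open>The constant for which the inequality for real variables reads \<open>H g \<le> gauss_moment l * \<rho> * T g\<close>.\<close>
    define \<rho> where "\<rho> = root k (B ^ (l - k) / gauss_moment k ^ l)"
    have \<rho>: "\<rho> \<ge> 0" "\<rho> ^ k = B ^ (l - k) / gauss_moment k ^ l"
      using B kl gauss_moment_pos[of k] by (simp_all add: \<rho>_def)
    have T0: "T g \<ge> 0" for g unfolding T_def using s W0 by (intro Bochner_Integration.integral_nonneg) auto
    have H_le: "H g \<le> gauss_moment l * \<rho> * T g" for g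
    proof -
      have "(H g / gauss_moment l) ^ k \<le> (expectation (\<lambda>\<omega>. S g \<omega> ^ (2 * k)) / gauss_moment k) ^ l"
        unfolding H_def by (rule type_L'_moment_comparison[OF LS kl])
      also have "expectation (\<lambda>\<omega>. S g \<omega> ^ (2 * k)) = expectation (\<lambda>\<omega>. s g \<omega> ^ k * W \<omega> ^ k)"
        using sk kl by simp
      also have "(expectation (\<lambda>\<omega>. s g \<omega> ^ k * W \<omega> ^ k) / gauss_moment k) ^ l
          \<le> (T g ^ k * B ^ (l - k)) / gauss_moment k ^ l"
      proof -
        have "expectation (\<lambda>\<omega>. s g \<omega> ^ k * W \<omega> ^ k) ^ l \<le> T g ^ k * B ^ (l - k)"
          unfolding T_def B_def
          by (rule weighted_power_mean[OF s(1) _ kl intW ints ints B[unfolded B_def]]) (simp add: W0)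
        then show ?thesis
          unfolding power_divide using gauss_moment_pos[of k] by (intro divide_right_mono) auto
      qed
      also have "\<dots> = (\<rho> * T g) ^ k" by (simp add: power_mult_distrib \<rho>)
      finally have "(H g / gauss_moment l) ^ Suc (k - 1) \<le> (\<rho> * T g) ^ Suc (k - 1)"
        using kl(1) by (simp only: Suc_diff_1)
      then have "H g / gauss_moment l \<le> \<rho> * T g"
        by (rule power_le_imp_le_base) (use \<rho>(1) T0[of g] in simp)
      then show ?thesis using gauss_moment_pos[of l] by (simp add: field_simps)
    qed
    have measS [measurable]: "(\<lambda>(g, \<omega>). S g \<omega>) \<in> borel_measurable (\<Gamma> \<Otimes>\<^sub>M M)"
    proof -
      have "(\<lambda>x. \<Sum>r<m. fst x r * Y r (snd x)) \<in> borel_measurable (\<Gamma> \<Otimes>\<^sub>M M)"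
        unfolding \<Gamma>_def
        by (intro borel_measurable_sum borel_measurable_times
            measurable_compose[OF measurable_fst gauss_space_measurable_component]
            measurable_compose[OF measurable_snd]) auto
      then show ?thesis by (simp add: S_def case_prod_unfold)
    qed
    have measS' [measurable]: "(\<lambda>g. S g \<omega>) \<in> borel_measurable \<Gamma>" for \<omega>
      unfolding S_def \<Gamma>_def
      by (intro borel_measurable_sum borel_measurable_times gauss_space_measurable_component) auto
    have gm: "(\<integral>\<^sup>+g. ennreal (S g \<omega> ^ (2 * l)) \<partial>\<Gamma>) = ennreal (gauss_moment l * W \<omega> ^ l)" for \<omega>
      unfolding S_def \<Gamma>_def W by (rule gauss_space_linear_moment)
    have gm': "(\<integral>\<^sup>+g. ennreal (s g \<omega> ^ l * W \<omega> ^ k) \<partial>\<Gamma>) = ennreal (gauss_moment l * W \<omega> ^ k)" for \<omega>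
    proof (cases "W \<omega> = 0")
      case True
      then show ?thesis using kl by (simp add: power_0_left)
    next
      case False
      then have Wp: "W \<omega> > 0" using W0[of \<omega>] by simp
      have e: "s g \<omega> ^ l * W \<omega> ^ k = (W \<omega> ^ k / W \<omega> ^ l) * S g \<omega> ^ (2 * l)" for g
        by (simp add: s_def power_divide power_mult)
      have "(\<integral>\<^sup>+g. ennreal (s g \<omega> ^ l * W \<omega> ^ k) \<partial>\<Gamma>)
          = (\<integral>\<^sup>+g. ennreal (W \<omega> ^ k / W \<omega> ^ l) * ennreal (S g \<omega> ^ (2 * l)) \<partial>\<Gamma>)"
        by (intro nn_integral_cong) (simp only: e, rule ennreal_mult, use Wp in auto)
      also have "\<dots> = ennreal (W \<omega> ^ k / W \<omega> ^ l) * ennreal (gauss_moment l * W \<omega> ^ l)"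
        by (subst nn_integral_cmult) (simp_all add: gm)
      also have "\<dots> = ennreal (gauss_moment l * W \<omega> ^ k)"
        using Wp gauss_moment_pos[of l] by (simp flip: ennreal_mult)
      finally show ?thesis .
    qed
    \<comment> \<open>Both sides of \<open>H_le\<close> are averaged over \<open>g\<close>; exchanging the integrals evaluates the averages by \<open>gm\<close> and \<open>gm'\<close>.\<close>
    have "ennreal (gauss_moment l * expectation (\<lambda>\<omega>. W \<omega> ^ l)) = (\<integral>\<^sup>+\<omega>. ennreal (gauss_moment l * W \<omega> ^ l) \<partial>M)"
      using intW W0 gauss_moment_pos[of l] by (subst nn_integral_eq_integral) (auto simp: less_imp_le)
    also have "\<dots> = (\<integral>\<^sup>+\<omega>. (\<integral>\<^sup>+g. ennreal (S g \<omega> ^ (2 * l)) \<partial>\<Gamma>) \<partial>M)" by (simp add: gm)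
    also have "\<dots> = (\<integral>\<^sup>+g. (\<integral>\<^sup>+\<omega>. ennreal (S g \<omega> ^ (2 * l)) \<partial>M) \<partial>\<Gamma>)"
      by (rule P.Fubini') measurable
    also have "\<dots> = (\<integral>\<^sup>+g. ennreal (H g) \<partial>\<Gamma>)"
      unfolding H_def by (subst nn_integral_eq_integral) (auto intro: type_L'_integrable_power LS)
    also have "\<dots> \<le> (\<integral>\<^sup>+g. ennreal (gauss_moment l * \<rho> * T g) \<partial>\<Gamma>)"
      by (intro nn_integral_mono ennreal_leI H_le)
    also have "\<dots> = (\<integral>\<^sup>+g. (\<integral>\<^sup>+\<omega>. ennreal (gauss_moment l * \<rho>) * ennreal (s g \<omega> ^ l * W \<omega> ^ k) \<partial>M) \<partial>\<Gamma>)"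
    proof (intro nn_integral_cong)
      fix g
      have "(\<integral>\<^sup>+\<omega>. ennreal (gauss_moment l * \<rho>) * ennreal (s g \<omega> ^ l * W \<omega> ^ k) \<partial>M)
        = ennreal (gauss_moment l * \<rho>) * (\<integral>\<^sup>+\<omega>. ennreal (s g \<omega> ^ l * W \<omega> ^ k) \<partial>M)"
        by (rule nn_integral_cmult) measurable
      also have "(\<integral>\<^sup>+\<omega>. ennreal (s g \<omega> ^ l * W \<omega> ^ k) \<partial>M) = ennreal (T g)"
        unfolding T_def using s W0 by (intro nn_integral_eq_integral ints) auto
      finally show "ennreal (gauss_moment l * \<rho> * T g) =
        (\<integral>\<^sup>+\<omega>. ennreal (gauss_moment l * \<rho>) * ennreal (s g \<omega> ^ l * W \<omega> ^ k) \<partial>M)"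
        using \<rho> T0 gauss_moment_pos[of l] by (simp add: ennreal_mult)
    qed
    also have "\<dots> = (\<integral>\<^sup>+\<omega>. (\<integral>\<^sup>+g. ennreal (gauss_moment l * \<rho>) * ennreal (s g \<omega> ^ l * W \<omega> ^ k) \<partial>\<Gamma>) \<partial>M)"
      by (rule P.Fubini'[symmetric]) (simp add: s_def, measurable)
    also have "\<dots> = (\<integral>\<^sup>+\<omega>. ennreal (gauss_moment l * \<rho> * gauss_moment l * W \<omega> ^ k) \<partial>M)"
    proof (intro nn_integral_cong)
      fix \<omega>
      have "(\<lambda>g. ennreal (s g \<omega> ^ l * W \<omega> ^ k)) \<in> borel_measurable \<Gamma>"
        unfolding s_def by measurable
      then have "(\<integral>\<^sup>+g. ennreal (gauss_moment l * \<rho>) * ennreal (s g \<omega> ^ l * W \<omega> ^ k) \<partial>\<Gamma>)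
        = ennreal (gauss_moment l * \<rho>) * ennreal (gauss_moment l * W \<omega> ^ k)"
        by (subst nn_integral_cmult) (simp_all add: gm')
      then show "(\<integral>\<^sup>+g. ennreal (gauss_moment l * \<rho>) * ennreal (s g \<omega> ^ l * W \<omega> ^ k) \<partial>\<Gamma>)
        = ennreal (gauss_moment l * \<rho> * gauss_moment l * W \<omega> ^ k)"
        using \<rho> W0[of \<omega>] gauss_moment_pos[of l] by (simp add: mult.assoc flip: ennreal_mult)
    qed
    also have "\<dots> = ennreal (gauss_moment l * \<rho> * gauss_moment l * B)"
      unfolding B_def using intW W0 gauss_moment_pos[of l] \<rho>
      by (subst nn_integral_eq_integral) (auto simp: less_imp_le)
    finally have "gauss_moment l * expectation (\<lambda>\<omega>. W \<omega> ^ l) \<le> gauss_moment l * \<rho> * gauss_moment l * B"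
      using \<rho> B gauss_moment_pos[of l] by (subst (asm) ennreal_le_iff) auto
    then have "expectation (\<lambda>\<omega>. W \<omega> ^ l) / gauss_moment l \<le> \<rho> * B"
      using gauss_moment_pos[of l] by (simp add: field_simps)
    then have "(expectation (\<lambda>\<omega>. W \<omega> ^ l) / gauss_moment l) ^ k \<le> (\<rho> * B) ^ k"
      using W0 gauss_moment_pos[of l]
      by (intro power_mono divide_nonneg_pos Bochner_Integration.integral_nonneg) auto
    also have "\<dots> = B ^ (l - k) * B ^ k / gauss_moment k ^ l"
      by (simp add: power_mult_distrib \<rho>)
    also have "B ^ (l - k) * B ^ k = B ^ l" using kl by (simp flip: power_add)
    finally show ?thesis by (simp add: B_def power_divide)
  qed
qed

end

section \<open>Sums with coefficients in a Hilbert space\<close>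

lemma gauss_moment_norm:
  assumes "distributed N lborel G std_normal_density"
  shows "moment_norm N (2 * k) G = gauss_moment k powr (1 / real (2 * k))"
proof -
  have "(\<integral>\<omega>. G \<omega> ^ (2 * k) \<partial>N) = (\<integral>x. std_normal_density x * x ^ (2 * k) \<partial>lborel)"
    by (rule distributed_integral[OF assms, symmetric]) auto
  also have "\<dots> = gauss_moment k"
    unfolding gauss_moment_def by (rule integral_std_normal_moment_even)
  finally show ?thesis by (simp add: moment_norm_def power_even_abs)
qed

text \<open>
  All that matters of the ambient space is that the squared norm of the sum is a real quadratic
  form in the variables: in a real space its matrix is the Gram matrix, in a complex space the
  real part of the Gram matrix.
\<close>

lemma moment_norm_comparison:
  fixes V :: "(nat \<Rightarrow> real) \<Rightarrow> 'a :: real_normed_vector" and A :: "nat \<Rightarrow> nat \<Rightarrow> real"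
  assumes M: "prob_space M"
    and ind: "prob_space.indep_vars M (\<lambda>_. borel) X {1..n}"
    and L: "\<And>j. j \<in> {1..n} \<Longrightarrow> type_L' M (X j)"
    and G: "distributed N lborel G std_normal_density"
    and A: "\<And>i j. A i j = A j i"
    and V: "\<And>x. (norm (V x))\<^sup>2 = (\<Sum>i\<in>{1..n}. \<Sum>j\<in>{1..n}. A i j * x i * x j)"
    and pq: "0 < p" "even p" "even q" "p \<le> q"
  shows "moment_norm M q (\<lambda>\<omega>. V (\<lambda>j. X j \<omega>)) \<le>
    moment_norm N q G / moment_norm N p G * moment_norm M p (\<lambda>\<omega>. V (\<lambda>j. X j \<omega>))"
proof -
  interpret prob_space M by (rule M)
  obtain k l where kl: "p = 2 * k" "q = 2 * l" using pq by (elim evenE)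
  have k: "0 < k" "k \<le> l" using pq kl by auto
  obtain m and b :: "nat \<Rightarrow> nat \<Rightarrow> real" where b:
    "\<And>x. (norm (V x))\<^sup>2 = (\<Sum>r<m. (\<Sum>j\<in>{1..n}. b r j * x j)\<^sup>2)"
    using psd_form_sum_of_squares[of "{1..n}" A] A unfolding V[symmetric] by auto
  define a where "a = (\<lambda>k. expectation (\<lambda>\<omega>. norm (V (\<lambda>j. X j \<omega>)) ^ (2 * k)))"
  have a0: "a k \<ge> 0" for k by (simp add: a_def)
  have a_eq: "expectation (\<lambda>\<omega>. norm (V (\<lambda>j. X j \<omega>)) ^ (2 * k)) = a k" for k
    by (simp add: a_def)
  have "(a l / gauss_moment l) ^ k \<le> (a k / gauss_moment k) ^ l"
    unfolding a_def power_mult b by (rule sum_of_squares_moment_comparison[OF _ ind L k]) auto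
  then have "((a l / gauss_moment l) ^ k) powr (1 / real (2 * k * l)) \<le> ((a k / gauss_moment k) ^ l) powr (1 / real (2 * k * l))"
    using a0 gauss_moment_pos by (intro powr_mono2 zero_le_power divide_nonneg_nonneg) (auto simp: less_imp_le)
  moreover have pw: "(y ^ i) powr (1 / real (2 * i * j)) = y powr (1 / real (2 * j))" if "y \<ge> 0" "i > 0" for y i j
  proof (cases "y = 0")
    case False
    then show ?thesis using that by (simp add: powr_powr flip: powr_realpow)
  qed (use that in simp)
  ultimately have "(a l / gauss_moment l) powr (1 / real (2 * l)) \<le> (a k / gauss_moment k) powr (1 / real (2 * k))"
    using pw[of "a l / gauss_moment l" k l] pw[of "a k / gauss_moment k" l k] a0 k
      gauss_moment_pos[of k] gauss_moment_pos[of l] by (simp add: mult_ac)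
  then have "a l powr (1 / real (2 * l)) / gauss_moment l powr (1 / real (2 * l))
      \<le> a k powr (1 / real (2 * k)) / gauss_moment k powr (1 / real (2 * k))"
    using a0 gauss_moment_pos[of k] gauss_moment_pos[of l] by (simp only: powr_divide less_imp_le)
  then show ?thesis
    unfolding kl gauss_moment_norm[OF G] unfolding moment_norm_def a_eq
    using gauss_moment_pos[of k] gauss_moment_pos[of l] by (simp add: field_simps)
qed

lemma norm_sum_scaleR_square:
  fixes v :: "nat \<Rightarrow> 'h :: real_inner"
  shows "(norm (\<Sum>j\<in>J. x j *\<^sub>R v j))\<^sup>2 = (\<Sum>i\<in>J. \<Sum>j\<in>J. (v i \<bullet> v j) * x i * x j)"
  by (simp add: power2_norm_eq_inner inner_sum_left inner_sum_right mult_ac sum_distrib_left inner_commute)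

lemma cinner_sum_left: "cinner (\<Sum>i\<in>J. f i) y = (\<Sum>i\<in>J. cinner (f i) y)"
proof (induction J rule: infinite_finite_induct)
  case (insert i J)
  then show ?case by (simp add: cinner_add_left)
qed (use cinner_add_left[of 0 0 y] in auto)

lemma norm_sum_scaleC_square:
  fixes v :: "nat \<Rightarrow> 'k :: complex_inner"
  shows "(norm (\<Sum>j\<in>J. scaleC (complex_of_real (x j)) (v j)))\<^sup>2
    = (\<Sum>i\<in>J. \<Sum>j\<in>J. Re (cinner (v i) (v j)) * x i * x j)"
proof -
  let ?s = "\<Sum>j\<in>J. scaleC (complex_of_real (x j)) (v j)"
  have right: "cinner y ?s = (\<Sum>j\<in>J. of_real (x j) * cinner y (v j))" for y
    by (subst cinner_commute)
      (simp add: cinner_sum_left cinner_scaleC_left cinner_commute[of y])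
  have "cinner ?s ?s = (\<Sum>i\<in>J. \<Sum>j\<in>J. cinner (v i) (v j) * of_real (x i) * of_real (x j))"
    unfolding right by (simp add: cinner_sum_left cinner_scaleC_left sum_distrib_left mult_ac) (subst sum.swap, simp add: mult_ac)
  then have "Re (complex_of_real ((norm ?s)\<^sup>2)) = Re (\<Sum>i\<in>J. \<Sum>j\<in>J. cinner (v i) (v j) * of_real (x i) * of_real (x j))"
    by (simp only: cinner_self)
  then show ?thesis by simp
qed

theorem corollary3:
  fixes M :: "'w measure" and N :: "'g measure"
    and X :: "nat \<Rightarrow> 'w \<Rightarrow> real" and G :: "'g \<Rightarrow> real" and n :: nat
  assumes "prob_space M"
    and "prob_space.indep_vars M (\<lambda>_. borel) X {1..n}"
    and "\<And>j. j \<in> {1..n} \<Longrightarrow> type_L' M (X j)"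
    and "prob_space N"
    and "distributed N lborel G std_normal_density"
  shows
    "(\<forall>v :: nat \<Rightarrow> 'h::{real_inner, polish_space}.
        \<forall>p q :: nat. 0 < p \<and> even p \<and> even q \<and> p \<le> q \<longrightarrow>
          moment_norm M q (\<lambda>\<omega>. \<Sum>j=1..n. scaleR (X j \<omega>) (v j))
            \<le> moment_norm N q G / moment_norm N p G
              * moment_norm M p (\<lambda>\<omega>. \<Sum>j=1..n. scaleR (X j \<omega>) (v j)))
   \<and> (\<forall>v :: nat \<Rightarrow> 'k::{complex_inner, polish_space}.
        \<forall>p q :: nat. 0 < p \<and> even p \<and> even q \<and> p \<le> q \<longrightarrow>
          moment_norm M q (\<lambda>\<omega>. \<Sum>j=1..n. scaleC (complex_of_real (X j \<omega>)) (v j))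
            \<le> moment_norm N q G / moment_norm N p G
              * moment_norm M p (\<lambda>\<omega>. \<Sum>j=1..n. scaleC (complex_of_real (X j \<omega>)) (v j)))"
proof (intro conjI allI impI)
  fix v :: "nat \<Rightarrow> 'h" and p q :: nat
  assume "0 < p \<and> even p \<and> even q \<and> p \<le> q"
  then show "moment_norm M q (\<lambda>\<omega>. \<Sum>j=1..n. scaleR (X j \<omega>) (v j))
            \<le> moment_norm N q G / moment_norm N p G
              * moment_norm M p (\<lambda>\<omega>. \<Sum>j=1..n. scaleR (X j \<omega>) (v j))"
    using moment_norm_comparison[OF assms(1-3,5), where V = "\<lambda>x. \<Sum>j=1..n. scaleR (x j) (v j)"
        and A = "\<lambda>i j. v i \<bullet> v j"]
    by (simp add: norm_sum_scaleR_square inner_commute)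
next
  fix v :: "nat \<Rightarrow> 'k" and p q :: nat
  assume "0 < p \<and> even p \<and> even q \<and> p \<le> q"
  moreover have "Re (cinner (v i) (v j)) = Re (cinner (v j) (v i))" for i j
    by (subst cinner_commute) simp
  ultimately show "moment_norm M q (\<lambda>\<omega>. \<Sum>j=1..n. scaleC (complex_of_real (X j \<omega>)) (v j))
            \<le> moment_norm N q G / moment_norm N p G
              * moment_norm M p (\<lambda>\<omega>. \<Sum>j=1..n. scaleC (complex_of_real (X j \<omega>)) (v j))"
    using moment_norm_comparison[OF assms(1-3,5),
        where V = "\<lambda>x. \<Sum>j=1..n. scaleC (complex_of_real (x j)) (v j)"
        and A = "\<lambda>i j. Re (cinner (v i) (v j))"]
    by (simp add: norm_sum_scaleC_square)
qed

end
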